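(* Let $f_1,\dots,f_M:\mathbb{R}^n\to\mathbb{R}$ be the continuously differentiable empirical risks described in the context, $f:\mathbb{R}^{nM}\to\mathbb{R}$, $f(z)=\sum_{j=1}^M f_j(z_j)$, $A=[I,\dots,I]^\top\in\mathbb{R}^{(nM)\times n}$, and $\phi(w)=\sum_{j=1}^M\widehat\phi(w_j)$, where $\phi$ satisfies (A1)--(A5) of the context. Let $(\bar u,\bar z)$ be a stationary point for the splitting model $$\min_{u,(z_j)_{j=1}^M\in\mathbb{R}^n}\ \sum_{j=1}^M f_j(z_j)+\frac1\lambda\widehat\phi(u-z_j)$$ satisfying $\bar u-\bar z_j\in\operatorname{dom}\widehat\phi$ (for all $j$) and the conditions $$0=\tfrac1\lambda A^\top\nabla\phi(A\bar u-\bar z),\qquad 0\in\partial f(\bar z)-\tfrac1\lambda\nabla\phi(A\bar u-\bar z).$$ If $f$ is prox-regular at $\bar z$ for $\bar y=\frac1\lambda\nabla\phi(A\bar u-\bar z)$ and $\phi$-prox-bounded with threshold $\lambda_f$, then for $\lambda\in(0,\lambda_f)$ sufficiently small, $\bar u$ is a stationary point of $\sum_{j=1}^M e_\lambda^{\widehat\phi}f_j$, i.e., $\sum_{j=1}^M e_\lambda^{\widehat\phi}f_j$ is Lipschitz differentiable around $\bar u$ and $$\sum_{j=1}^M\nabla e_\lambda^{\widehat\phi}f_j(\bar u)=0.$$ If in addition $\mathcal{I}_j=\mathcal{I}$ for all $1\le j\le M$ and therefore $f_j=\hat f$, the stationarity condition reduces to $$0=\nabla e_\lambda^{\widehat\phi}\hat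 f(\bar u),$$ and it holds that $\bar u=\bar z_j$ for all $j$ and $0\in\partial\hat f(\bar u)$.
   Context: $\overline{\mathbb{R}}=\mathbb{R}\cup\{+\infty,-\infty\}$; $\operatorname{dom}h=\{z:h(z)<\infty\}$; lsc means lower semicontinuous. Vectors in $\mathbb{R}^{nM}$ are written $z=(z_1,\dots,z_M)$ with $z_j\in\mathbb{R}^n$; $\widehat\phi:\mathbb{R}^n\to\overline{\mathbb{R}}$. A stationary point of the splitting model is a point at which $0$ belongs to the (limiting) subdifferential of its objective. Empirical risks: $\mathcal{I}$ indexes the full set of training pairs $(x_i,h_i)$, $\mathcal{I}_j$ indexes a subset of it for each $j=1,\dots,M$, and $f_j(z_j)=\frac1{|\mathcal{I}_j|}\sum_{i\in\mathcal{I}_j}\ell(h_i,H(x_i;z_j))+R(z_j)$ for a prediction function $H(\cdot;z)$ parameterized by weights $z$, a loss function $\ell$ and a regularizer $R$, each $f_j:\mathbb{R}^n\to\mathbb{R}$ being continuously differentiable. When $\mathcal{I}_j=\mathcal{I}$ for all $j$, all $f_j$ coincide with one function denoted $\hat f$. Legendre functions: a proper convex lsc $\phi$ (proper: $>-\infty$ everywhere and $<\infty$ somewhere) is essentially smooth if $\operatorname{int}\operatorname{dom}\phi\neq\emptyset$ and $\phi$ is differentiable on $\operatorname{int}\operatorname{dom}\phi$ such that $\|\nabla\phi(w^\nu)\|\to\infty$ whenever $w^\nu\to w\in\operatorname{bdry}\operatorname{dom}\phi$; essentially strictly convex if it is strictly convex on every convex subset of $\{w:\partial\phi(w)\neq\emptyset\}$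 ($\partial\phi$ the convex subdifferential); Legendre if both. Assumptions on $\phi$: (A1) $\phi$ is proper lsc convex and Legendre; (A2) $\operatorname{dom}\phi$ is open; (A3) $\phi$ is twice continuously differentiable on $\operatorname{int}\operatorname{dom}\phi$ with $\nabla^2\phi(w)\succ0$ for all $w\in\operatorname{int}\operatorname{dom}\phi$; (A4) $\phi$ is super-coercive: $|\phi(w)|/\|w\|\to\infty$ whenever $\|w\|\to\infty$; (A5) $\phi(0)=0$ and $\nabla\phi(0)=0$. For $\lambda>0$ and functions $h,\psi$ on $\mathbb{R}^k$, $e_\lambda^\psi h(v)=\inf_{z\in\mathbb{R}^k}h(z)+\tfrac1\lambda\psi(v-z)$. A function is Lipschitz differentiable around a point if it is differentiable with Lipschitz continuous gradient on a neighborhood of that point. $f$ is $\phi$-prox-bounded if there exists $\lambda>0$ such that for any $\bar v$ there exist $\epsilon>0$ and $\beta>-\infty$ with $e_\lambda^\phi f(v)\ge\beta$ for any $v$ with $\|v-\bar v\|\le\epsilon$. The supremum of the set of all such $\lambda$ is the threshold $\lambda_f$. Subdifferentials: for $f$ finite at $\bar z$, $y\in\widehat\partial f(\bar z)$ (regular subdifferential) if $\liminf_{z\to\bar z,\,z\neq\bar z}\frac{f(z)-f(\bar z)-\langle y,z-\bar z\rangle}{\|z-\bar z\|}\ge0$; $y\in\partial f(\bar z)$ (limiting subdifferential) if there exist $z^\nu\to\bar z$ with $f(z^\nu)\to f(\bar z)$ and $y^\nu\in\widehat\partial f(z^\nu)$ with $y^\nu\to y$. Prox-regularity: $f$, lsc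 and finite at $\bar z$, is prox-regular at $\bar z$ for $\bar y\in\partial f(\bar z)$ if there exist $\epsilon>0$ and $r\ge0$ such that for all $\|z'-\bar z\|<\epsilon$, $f(z')\ge f(z)+\langle y,z'-z\rangle-\frac r2\|z'-z\|^2$ whenever $\|z-\bar z\|<\epsilon$, $f(z)-f(\bar z)<\epsilon$, $y\in\partial f(z)$, $\|y-\bar y\|<\epsilon$. *)

theory Defs
  imports "HOL-Analysis.Analysis"
begin

text \<open>Functions into the extended reals have type \<^typ>\<open>'a \<Rightarrow> ereal\<close>. Addition on \<^typ>\<open>ereal\<close> follows
  the inf-addition convention \<open>\<infinity> + (-\<infinity>) = \<infinity>\<close>.\<close>

definition edom :: "('a \<Rightarrow> ereal) \<Rightarrow> 'a set" where
  "edom h = {z. h z < \<infinity>}"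

definition proper_fun :: "('a \<Rightarrow> ereal) \<Rightarrow> bool" where
  "proper_fun h \<longleftrightarrow> (\<forall>z. h z > -\<infinity>) \<and> (\<exists>z. h z < \<infinity>)"

definition lsc_fun :: "('a::topological_space \<Rightarrow> ereal) \<Rightarrow> bool" where
  "lsc_fun h \<longleftrightarrow> (\<forall>z. h z \<le> Liminf (at z) h)"

definition convex_fun :: "('a::real_vector \<Rightarrow> ereal) \<Rightarrow> bool" where
  "convex_fun h \<longleftrightarrow> (\<forall>x y. \<forall>t::real. 0 < t \<and> t < 1 \<longrightarrow>
     h ((1 - t) *\<^sub>R x + t *\<^sub>R y) \<le> ereal (1 - t) * h x + ereal t * h y)"

definition strictly_convex_fun_on :: "'a::real_vector set \<Rightarrow> ('a \<Rightarrow> ereal) \<Rightarrow> bool" where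
  "strictly_convex_fun_on C h \<longleftrightarrow> (\<forall>x\<in>C. \<forall>y\<in>C. \<forall>t::real. x \<noteq> y \<and> 0 < t \<and> t < 1 \<longrightarrow>
     h ((1 - t) *\<^sub>R x + t *\<^sub>R y) < ereal (1 - t) * h x + ereal t * h y)"


subsection \<open>Gradients of extended-real-valued functions\<close>

text \<open>Differentiability at a point presupposes that the function is finite near that point.\<close>

definition has_egrad :: "('a::real_inner \<Rightarrow> ereal) \<Rightarrow> 'a \<Rightarrow> 'a \<Rightarrow> bool" where
  "has_egrad h z g \<longleftrightarrow> (\<forall>\<^sub>F x in nhds z. \<bar>h x\<bar> \<noteq> \<infinity>) \<and> (GDERIV (\<lambda>x. real_of_ereal (h x)) z :> g)"

definition ediff :: "('a::real_inner \<Rightarrow> ereal) \<Rightarrow> 'a \<Rightarrow> bool" where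
  "ediff h z \<longleftrightarrow> (\<exists>g. has_egrad h z g)"

definition egrad :: "('a::real_inner \<Rightarrow> ereal) \<Rightarrow> 'a \<Rightarrow> 'a" where
  "egrad h z = (THE g. has_egrad h z g)"

definition lipschitz_diff_around :: "('a::real_inner \<Rightarrow> ereal) \<Rightarrow> 'a \<Rightarrow> bool" where
  "lipschitz_diff_around h z \<longleftrightarrow>
     (\<exists>\<epsilon>>0. \<exists>L. (\<forall>x\<in>ball z \<epsilon>. ediff h x) \<and> L-lipschitz_on (ball z \<epsilon>) (egrad h))"

definition continuously_diff :: "('a::real_inner \<Rightarrow> real) \<Rightarrow> bool" where
  "continuously_diff f \<longleftrightarrow> (\<exists>g. continuous_on UNIV g \<and> (\<forall>z. GDERIV f z :> g z))"


subsection \<open>Subdifferentials\<close>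

definition convex_subdiff :: "('a::real_inner \<Rightarrow> ereal) \<Rightarrow> 'a \<Rightarrow> 'a set" where
  "convex_subdiff h w = {y. \<bar>h w\<bar> \<noteq> \<infinity> \<and> (\<forall>x. h x \<ge> h w + ereal (y \<bullet> (x - w)))}"

definition regular_subdiff :: "('a::real_inner \<Rightarrow> ereal) \<Rightarrow> 'a \<Rightarrow> 'a set" where
  "regular_subdiff f zb = {y. \<bar>f zb\<bar> \<noteq> \<infinity> \<and>
     Liminf (at zb) (\<lambda>z. (f z - f zb - ereal (y \<bullet> (z - zb))) / ereal (norm (z - zb))) \<ge> 0}"

definition limiting_subdiff :: "('a::real_inner \<Rightarrow> ereal) \<Rightarrow> 'a \<Rightarrow> 'a set" where
  "limiting_subdiff f zb = {y. \<bar>f zb\<bar> \<noteq> \<infinity> \<and>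
     (\<exists>zs ys. zs \<longlonglongrightarrow> zb \<and> (\<lambda>\<nu>. f (zs \<nu>)) \<longlonglongrightarrow> f zb \<and>
        (\<forall>\<nu>. ys \<nu> \<in> regular_subdiff f (zs \<nu>)) \<and> ys \<longlonglongrightarrow> y)}"


subsection \<open>Prox-regularity, envelopes and prox-boundedness\<close>

text \<open>The constants of prox-regularity are kept visible, because how small \<open>lam\<close> has to be in
  results on envelopes depends on them.\<close>

definition prox_regular_with ::
    "real \<Rightarrow> real \<Rightarrow> ('a::real_inner \<Rightarrow> ereal) \<Rightarrow> 'a \<Rightarrow> 'a \<Rightarrow> bool" where
  "prox_regular_with \<epsilon> r f zb yb \<longleftrightarrow>
     0 < \<epsilon> \<and> 0 \<le> r \<and> lsc_fun f \<and> \<bar>f zb\<bar> \<noteq> \<infinity> \<and> yb \<in> limiting_subdiff f zb \<and>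
     (\<forall>z' z y. norm (z' - zb) < \<epsilon> \<and> norm (z - zb) < \<epsilon> \<and> f z - f zb < ereal \<epsilon> \<and>
        y \<in> limiting_subdiff f z \<and> norm (y - yb) < \<epsilon> \<longrightarrow>
        f z' \<ge> f z + ereal (y \<bullet> (z' - z) - r / 2 * (norm (z' - z))\<^sup>2))"

definition prox_regular :: "('a::real_inner \<Rightarrow> ereal) \<Rightarrow> 'a \<Rightarrow> 'a \<Rightarrow> bool" where
  "prox_regular f zb yb \<longleftrightarrow> (\<exists>\<epsilon> r. prox_regular_with \<epsilon> r f zb yb)"

definition envelope ::
    "real \<Rightarrow> ('a::real_vector \<Rightarrow> ereal) \<Rightarrow> ('a \<Rightarrow> ereal) \<Rightarrow> 'a \<Rightarrow> ereal" where
  "envelope lam \<psi> h v = (INF z. h z + ereal (1 / lam) * \<psi> (v - z))"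

definition prox_bound_params ::
    "('a::real_normed_vector \<Rightarrow> ereal) \<Rightarrow> ('a \<Rightarrow> ereal) \<Rightarrow> real set" where
  "prox_bound_params \<phi> f = {lam. 0 < lam \<and> (\<forall>vb. \<exists>\<epsilon>>0. \<exists>\<beta>. \<beta> > -\<infinity> \<and>
     (\<forall>v. norm (v - vb) \<le> \<epsilon> \<longrightarrow> envelope lam \<phi> f v \<ge> \<beta>))}"

definition prox_bounded ::
    "('a::real_normed_vector \<Rightarrow> ereal) \<Rightarrow> ('a \<Rightarrow> ereal) \<Rightarrow> bool" where
  "prox_bounded \<phi> f \<longleftrightarrow> prox_bound_params \<phi> f \<noteq> {}"

definition prox_threshold ::
    "('a::real_normed_vector \<Rightarrow> ereal) \<Rightarrow> ('a \<Rightarrow> ereal) \<Rightarrow> ereal" where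
  "prox_threshold \<phi> f = Sup (ereal ` prox_bound_params \<phi> f)"


subsection \<open>Legendre functions and the standing assumptions on the penalty\<close>

definition essentially_smooth :: "('a::euclidean_space \<Rightarrow> ereal) \<Rightarrow> bool" where
  "essentially_smooth \<phi> \<longleftrightarrow>
     interior (edom \<phi>) \<noteq> {} \<and> (\<forall>w\<in>interior (edom \<phi>). ediff \<phi> w) \<and>
     (\<forall>ws w. (\<forall>\<nu>. ws \<nu> \<in> interior (edom \<phi>)) \<and> ws \<longlonglongrightarrow> w \<and> w \<in> frontier (edom \<phi>) \<longrightarrow>
        filterlim (\<lambda>\<nu>. norm (egrad \<phi> (ws \<nu>))) at_top sequentially)"

definition essentially_strictly_convex :: "('a::euclidean_space \<Rightarrow> ereal) \<Rightarrow> bool" where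
  "essentially_strictly_convex \<phi> \<longleftrightarrow>
     (\<forall>C. convex C \<and> C \<subseteq> {w. convex_subdiff \<phi> w \<noteq> {}} \<longrightarrow> strictly_convex_fun_on C \<phi>)"

definition legendre :: "('a::euclidean_space \<Rightarrow> ereal) \<Rightarrow> bool" where
  "legendre \<phi> \<longleftrightarrow> proper_fun \<phi> \<and> lsc_fun \<phi> \<and> convex_fun \<phi> \<and>
     essentially_smooth \<phi> \<and> essentially_strictly_convex \<phi>"

text \<open>In \<open>twice_cont_diff_pd\<close> the Hessian at \<open>w\<close> is the bounded linear map \<open>H w\<close>.\<close>

definition twice_cont_diff_pd :: "('a::euclidean_space \<Rightarrow> ereal) \<Rightarrow> bool" where
  "twice_cont_diff_pd \<phi> \<longleftrightarrow>
     (\<forall>w\<in>interior (edom \<phi>). ediff \<phi> w) \<and>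
     (\<exists>H :: 'a \<Rightarrow> ('a \<Rightarrow>\<^sub>L 'a). continuous_on (interior (edom \<phi>)) H \<and>
        (\<forall>w\<in>interior (edom \<phi>).
           (egrad \<phi> has_derivative blinfun_apply (H w)) (at w) \<and>
           (\<forall>d. d \<noteq> 0 \<longrightarrow> 0 < d \<bullet> blinfun_apply (H w) d)))"

definition supercoercive :: "('a::euclidean_space \<Rightarrow> ereal) \<Rightarrow> bool" where
  "supercoercive \<phi> \<longleftrightarrow> ((\<lambda>w. \<bar>\<phi> w\<bar> / ereal (norm w)) \<longlongrightarrow> \<infinity>) at_infinity"

definition penalty_assms :: "('a::euclidean_space \<Rightarrow> ereal) \<Rightarrow> bool" where
  "penalty_assms \<phi> \<longleftrightarrow> legendre \<phi> \<and> open (edom \<phi>) \<and> twice_cont_diff_pd \<phi> \<and>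
     supercoercive \<phi> \<and> \<phi> 0 = 0 \<and> egrad \<phi> 0 = 0"


subsection \<open>Splitting of empirical risks\<close>

text \<open>\<open>\<real>\<^sup>n\<^sup>M\<close> is \<^typ>\<open>real^'n^'m\<close>, with blocks \<open>z $ j\<close>. The matrix \<open>A = [I, \<dots>, I]\<^sup>T\<close> is the linear map
  \<open>stack\<close>, and its transpose is \<open>adjoint stack\<close>.\<close>

definition stack :: "real^'n \<Rightarrow> real^'n^'m" where
  "stack u = (\<chi> j. u)"

definition empirical_risk ::
    "('y \<Rightarrow> 'p \<Rightarrow> real) \<Rightarrow> ('x \<Rightarrow> 'w \<Rightarrow> 'p) \<Rightarrow> ('w \<Rightarrow> real) \<Rightarrow> ('i \<Rightarrow> 'x) \<Rightarrow> ('i \<Rightarrow> 'y) \<Rightarrow>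
     'i set \<Rightarrow> 'w \<Rightarrow> real" where
  "empirical_risk loss pred reg x h S z =
     1 / real (card S) * (\<Sum>i\<in>S. loss (h i) (pred (x i) z)) + reg z"

definition separable_sum :: "(real^'n \<Rightarrow> ereal) \<Rightarrow> real^'n^'m \<Rightarrow> ereal" where
  "separable_sum \<phi>h w = (\<Sum>j\<in>UNIV. \<phi>h (w $ j))"

definition splitting_objective ::
    "real \<Rightarrow> (real^'n \<Rightarrow> ereal) \<Rightarrow> ('m \<Rightarrow> real^'n \<Rightarrow> real) \<Rightarrow> (real^'n) \<times> (real^'n^'m) \<Rightarrow> ereal" where
  "splitting_objective lam \<phi>h f =
     (\<lambda>(u, z). \<Sum>j\<in>UNIV. ereal (f j (z $ j)) + ereal (1 / lam) * \<phi>h (u - z $ j))"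

end

theory Submission
  imports Defs
begin

text \<open>
  The argument is local and runs one block at a time. Write \<open>g j\<close> for the gradient of \<open>f j\<close>. Since \<open>F\<close> is smooth, its limiting
  subdifferential at \<open>zb\<close> is the single gradient with blocks \<open>g j (zb $ j)\<close>, so the second stationarity
  condition says \<open>g j (zb $ j) = (1 / lam) *\<^sub>R egrad \<phi>h (ub - zb $ j)\<close> for every \<open>j\<close>: the block \<open>zb $ j\<close>
  is a critical point of \<open>z \<mapsto> f j z + \<phi>h (ub - z) / lam\<close>, the problem that defines the envelope of
  \<open>f j\<close> at \<open>ub\<close>. Once the envelope is known to be differentiable at \<open>ub\<close> with gradient \<open>g j (zb $ j)\<close>,
  summing over \<open>j\<close> and using that the adjoint of \<open>stack\<close> adds up the blocks gives the stationarity
  of the summed envelopes.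

  The differentiability holds because the penalty beats the nonconvexity of \<open>f j\<close>. Near the origin
  \<open>\<phi>h\<close> is strongly convex with Lipschitz gradient (\<open>smooth_penalty_local\<close>), and prox-regularity
  bounds the nonconvexity of \<open>f j\<close> near \<open>zb $ j\<close> by \<open>r\<close> (\<open>prox_regular_block\<close>). For small \<open>lam\<close> the
  sum has one critical point near \<open>zb $ j\<close>, which depends on the base point in a Lipschitz way.
  The envelope then has a quadratic first-order remainder (\<open>envelope_lipschitz_diff\<close>).

  Smallness of \<open>lam\<close> has to localise the minimisers, uniformly over the bounded set \<open>Z\<close>
  (\<open>envelope_lipschitz_diff_small_lam\<close>). Away from the origin \<open>\<phi>h\<close> grows at least linearly and its
  gradient stays away from zero (\<open>smooth_penalty_growth\<close>). The first fact, compared with a uniform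
  lower bound of the envelope for one fixed larger parameter (\<open>prox_bound_block\<close>), keeps minimisers
  close to the base point; the second one, applied to \<open>egrad \<phi>h (ub - zb $ j) = lam *\<^sub>R g j (zb $ j)\<close>,
  forces \<open>ub\<close> to be close to every block \<open>zb $ j\<close>.

  When all blocks share one risk, the stationarity condition is \<open>CARD('m)\<close> times a single gradient,
  so \<open>egrad \<phi>h (ub - zb $ j) = 0\<close>; the gradient of the penalty vanishes only at the origin, hence
  \<open>ub = zb $ j\<close>, where the gradient of the risk is zero.
\<close>

section \<open>Gradients and subdifferentials of smooth functions\<close>

lemma GDERIV_unique:
  assumes "GDERIV f x :> a" "GDERIV f x :> b"
  shows "a = b"
proof -
  have "(\<lambda>h. inner h a) = (\<lambda>h. inner h b)"
    using assms unfolding gderiv_def by (rule has_derivative_unique)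
  then have "inner (a - b) a = inner (a - b) b" by meson
  then have "inner (a - b) (a - b) = 0" by (simp add: inner_diff_right)
  then show ?thesis by simp
qed

lemma egrad_eq: "has_egrad h z g \<Longrightarrow> egrad h z = g"
  unfolding egrad_def by (rule the_equality) (auto simp: has_egrad_def intro: GDERIV_unique)

lemma has_egrad_egrad: "ediff h z \<Longrightarrow> has_egrad h z (egrad h z)"
  using egrad_eq unfolding ediff_def by metis

lemma has_egrad_ereal: "GDERIV f z :> g \<Longrightarrow> has_egrad (\<lambda>z. ereal (f z)) z g"
  by (simp add: has_egrad_def)

lemma has_egrad_cong:
  assumes "\<forall>\<^sub>F x in nhds z. h x = k x" "has_egrad h z g"
  shows "has_egrad k z g"
proof -
  have "\<forall>\<^sub>F x in nhds z. \<bar>k x\<bar> \<noteq> \<infinity>"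
    using assms unfolding has_egrad_def by (auto elim: eventually_elim2)
  moreover have "\<forall>\<^sub>F x in nhds z. real_of_ereal (h x) = real_of_ereal (k x)"
    using assms(1) by (rule eventually_mono) simp
  then have "\<forall>\<^sub>F x in at z. real_of_ereal (h x) = real_of_ereal (k x)"
      "real_of_ereal (h z) = real_of_ereal (k z)"
    by (simp_all add: eventually_nhds_conv_at)
  with assms(2) have "GDERIV (\<lambda>x. real_of_ereal (k x)) z :> g"
    unfolding has_egrad_def gderiv_def by (blast intro: has_derivative_transform_eventually)
  ultimately show ?thesis by (simp add: has_egrad_def)
qed

lemma has_egrad_add:
  assumes "has_egrad h z a" "has_egrad k z b"
  shows "has_egrad (\<lambda>x. h x + k x) z (a + b)"
proof -
  have fin: "\<forall>\<^sub>F x in nhds z. \<bar>h x\<bar> \<noteq> \<infinity> \<and> \<bar>k x\<bar> \<noteq> \<infinity>"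
    using assms unfolding has_egrad_def by (auto elim: eventually_elim2)
  have "has_egrad (\<lambda>x. ereal (real_of_ereal (h x) + real_of_ereal (k x))) z (a + b)"
    using assms unfolding has_egrad_def by (auto intro: GDERIV_add)
  moreover have "\<forall>\<^sub>F x in nhds z. ereal (real_of_ereal (h x) + real_of_ereal (k x)) = h x + k x"
    using fin by (rule eventually_mono) (metis plus_ereal.simps(1) ereal_real)
  ultimately show ?thesis by (rule has_egrad_cong[rotated])
qed

lemma lipschitz_diff_around_sum:
  fixes z :: "'a::real_inner"
  assumes "finite J" "\<And>j. j \<in> J \<Longrightarrow> lipschitz_diff_around (h j) z"
  shows "lipschitz_diff_around (\<lambda>x. \<Sum>j\<in>J. h j x) z"
  using assms
proof (induction J)
  case empty
  have "has_egrad (\<lambda>x. 0::ereal) x (0::'a)" for x by (auto simp: has_egrad_def GDERIV_const)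
  then have "ediff (\<lambda>x. 0::ereal) x" "egrad (\<lambda>x. 0::ereal) x = 0" for x :: 'a
    by (auto simp: ediff_def egrad_eq)
  then show ?case unfolding lipschitz_diff_around_def
    by (intro exI[of _ 1] conjI exI[of _ 0]) (auto simp: lipschitz_on_def)
next
  case (insert j J)
  from insert.prems obtain a K where a: "a > 0" "\<And>x. x \<in> ball z a \<Longrightarrow> ediff (h j) x"
    "K-lipschitz_on (ball z a) (egrad (h j))"
    unfolding lipschitz_diff_around_def by (meson insertI1)
  from insert obtain b L where b: "b > 0" "\<And>x. x \<in> ball z b \<Longrightarrow> ediff (\<lambda>x. \<Sum>j\<in>J. h j x) x"
    "L-lipschitz_on (ball z b) (egrad (\<lambda>x. \<Sum>j\<in>J. h j x))"
    unfolding lipschitz_diff_around_def by auto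
  let ?c = "min a b"
  let ?h = "\<lambda>x. \<Sum>j\<in>insert j J. h j x"
  let ?g = "\<lambda>x. egrad (h j) x + egrad (\<lambda>x. \<Sum>j\<in>J. h j x) x"
  have g: "has_egrad ?h x (?g x)" if "x \<in> ball z ?c" for x
    using that a b insert by (simp add: has_egrad_add has_egrad_egrad)
  have "(K + L)-lipschitz_on (ball z ?c) ?g"
    by (rule lipschitz_on_add[OF lipschitz_on_subset[OF a(3)] lipschitz_on_subset[OF b(3)]]) auto
  then have "(K + L)-lipschitz_on (ball z ?c) (egrad ?h)"
    by (auto simp: lipschitz_on_def egrad_eq[OF g] simp del: sum.insert mem_ball)
  moreover have "\<forall>x\<in>ball z ?c. ediff ?h x" using g unfolding ediff_def by blast
  moreover have "?c > 0" using a b by simp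
  ultimately show ?case unfolding lipschitz_diff_around_def by blast
qed

text \<open>A regular subgradient \<open>y\<close> that differs from the gradient \<open>g\<close> is refuted along the
  direction \<open>y - g\<close>: the difference of the two difference quotients there is constantly
  \<open>norm (y - g)\<close>, although the quotient of \<open>y\<close> has nonnegative lower limit and that of \<open>g\<close> tends
  to zero.\<close>
lemma regular_subdiff_smooth:
  assumes "GDERIV f z :> g"
  shows "regular_subdiff (\<lambda>z. ereal (f z)) z = {g}"
proof -
  define q where "q y z' = (f z' - f z - inner y (z' - z)) / norm (z' - z)" for y z'
  have "((\<lambda>z'. q g z') \<longlongrightarrow> 0) (at z)"
    using assms unfolding gderiv_def has_derivative_at_within q_def
    by (simp add: inner_commute divide_inverse mult.commute diff_diff_eq)
  then have qg: "\<forall>\<^sub>F z' in at z. \<bar>q g z'\<bar> < e" if "e > 0" for e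
    using that by (auto simp: tendsto_iff)
  have mem: "y \<in> regular_subdiff (\<lambda>z. ereal (f z)) z
      \<longleftrightarrow> (\<forall>e>0. \<forall>\<^sub>F z' in at z. - e < q y z')" for y
  proof -
    have "\<forall>\<^sub>F z' in at z. (ereal (f z') - ereal (f z) - ereal (inner y (z' - z)))
        / ereal (norm (z' - z)) = ereal (q y z')"
      by (auto simp: eventually_at_filter q_def)
    then have "Liminf (at z) (\<lambda>z'. (ereal (f z') - ereal (f z) - ereal (inner y (z' - z)))
        / ereal (norm (z' - z))) = Liminf (at z) (\<lambda>z'. ereal (q y z'))"
      by (rule Liminf_eq)
    then have "y \<in> regular_subdiff (\<lambda>z. ereal (f z)) z
        \<longleftrightarrow> (\<forall>e<0. \<forall>\<^sub>F z' in at z. e < ereal (q y z'))"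
      unfolding regular_subdiff_def mem_Collect_eq le_Liminf_iff[symmetric] by simp
    also have "\<dots> \<longleftrightarrow> (\<forall>e>0. \<forall>\<^sub>F z' in at z. - e < q y z')" (is "?L \<longleftrightarrow> ?R")
    proof
      assume L: ?L
      show ?R
      proof (intro allI impI)
        fix e :: real assume "e > 0"
        with L[rule_format, of "ereal (- e)"] show "\<forall>\<^sub>F z' in at z. - e < q y z'" by simp
      qed
    next
      assume R: ?R
      show ?L
      proof (intro allI impI)
        fix e :: ereal assume "e < 0"
        then obtain r where r: "e < ereal r" "ereal r < 0" using ereal_dense2 by blast
        then have "- r > 0" by simp
        from R[rule_format, OF this] show "\<forall>\<^sub>F z' in at z. e < ereal (q y z')"
          by (rule eventually_mono) (use r in \<open>auto intro: less_trans\<close>)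
      qed
    qed
    finally show ?thesis .
  qed
  have "y = g" if "y \<in> regular_subdiff (\<lambda>z. ereal (f z)) z" for y
  proof (rule ccontr)
    assume "y \<noteq> g"
    define e where "e = norm (y - g) / 2"
    have e: "e > 0" using \<open>y \<noteq> g\<close> by (simp add: e_def)
    have "\<forall>\<^sub>F z' in at z. - e < q y z' \<and> \<bar>q g z'\<bar> < e"
      using that e qg mem by (simp add: eventually_conj_iff)
    then obtain d where d: "d > 0"
      "\<And>z'. z' \<noteq> z \<Longrightarrow> dist z' z < d \<Longrightarrow> - e < q y z' \<and> \<bar>q g z'\<bar> < e"
      unfolding eventually_at by auto
    define t where "t = d / (2 * norm (y - g))"
    define z' where "z' = z + t *\<^sub>R (y - g)"
    have t: "t > 0" using d \<open>y \<noteq> g\<close> by (simp add: t_def)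
    have "z' \<noteq> z" "dist z' z < d" using t \<open>y \<noteq> g\<close> d by (auto simp: z'_def dist_norm t_def)
    with d have "q g z' - q y z' < 2 * e" by fastforce
    also have "q g z' - q y z' = inner (y - g) (z' - z) / norm (z' - z)"
      by (simp add: q_def diff_divide_distrib[symmetric] inner_diff_left)
    also have "\<dots> = norm (y - g)"
      using t \<open>y \<noteq> g\<close> by (simp add: z'_def power2_norm_eq_inner[symmetric] power2_eq_square)
    finally show False by (simp add: e_def)
  qed
  moreover have "g \<in> regular_subdiff (\<lambda>z. ereal (f z)) z"
    unfolding mem by (intro allI impI, rule eventually_mono[OF qg]) (auto simp: abs_less_iff)
  ultimately show ?thesis by blast
qed

lemma limiting_subdiff_smooth:
  assumes "\<And>z. GDERIV f z :> g z" "continuous_on UNIV g"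
  shows "limiting_subdiff (\<lambda>z. ereal (f z)) z = {g z}"
proof -
  have "y = g z" if "y \<in> limiting_subdiff (\<lambda>z. ereal (f z)) z" for y
  proof -
    from that obtain zs ys where *: "zs \<longlonglongrightarrow> z" "ys \<longlonglongrightarrow> y"
      "\<And>\<nu>. ys \<nu> \<in> regular_subdiff (\<lambda>z. ereal (f z)) (zs \<nu>)"
      unfolding limiting_subdiff_def by auto
    have "ys = (\<lambda>\<nu>. g (zs \<nu>))" using *(3) regular_subdiff_smooth[OF assms(1)] by auto
    moreover have "(\<lambda>\<nu>. g (zs \<nu>)) \<longlonglongrightarrow> g z"
      by (rule continuous_on_tendsto_compose[OF assms(2) *(1)]) auto
    ultimately show ?thesis using * LIMSEQ_unique by blast
  qed
  moreover have "g z \<in> limiting_subdiff (\<lambda>z. ereal (f z)) z"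
    unfolding limiting_subdiff_def using regular_subdiff_smooth[OF assms(1)]
    by (simp, intro exI[of _ "\<lambda>_. z"], auto)
  ultimately show ?thesis by blast
qed


section \<open>Smooth penalties near the origin and at infinity\<close>

text \<open>These conditions pass from a separable sum to its summand, so that the envelopes of the single
  blocks can be studied one at a time.\<close>
definition smooth_penalty :: "('a::euclidean_space \<Rightarrow> ereal) \<Rightarrow> bool" where
  "smooth_penalty \<psi> \<longleftrightarrow> (\<forall>w. \<psi> w \<noteq> -\<infinity>) \<and> convex_fun \<psi> \<and> open (edom \<psi>) \<and>
     twice_cont_diff_pd \<psi> \<and> \<psi> 0 = 0 \<and> egrad \<psi> 0 = 0"

lemma smooth_penalty_zero_mem: "smooth_penalty \<psi> \<Longrightarrow> 0 \<in> edom \<psi>"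
  by (simp add: smooth_penalty_def edom_def)

lemma smooth_penalty_finite:
  "smooth_penalty \<psi> \<Longrightarrow> w \<in> edom \<psi> \<Longrightarrow> ereal (real_of_ereal (\<psi> w)) = \<psi> w"
  by (cases "\<psi> w") (auto simp: smooth_penalty_def edom_def)

lemma smooth_penalty_has_egrad:
  assumes "smooth_penalty \<psi>" "w \<in> edom \<psi>"
  shows "has_egrad \<psi> w (egrad \<psi> w)"
  using assms unfolding smooth_penalty_def twice_cont_diff_pd_def
  by (auto simp: interior_open intro: has_egrad_egrad)

text \<open>By convexity the slope of \<open>\<psi>\<close> along the segment from \<open>y\<close> to \<open>x\<close> is at most
  \<open>\<psi> x - \<psi> y\<close>, and its limit at \<open>y\<close> is the directional derivative.\<close>
lemma smooth_penalty_tangent: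
  assumes \<psi>: "smooth_penalty \<psi>" and y: "y \<in> edom \<psi>"
  shows "\<psi> x \<ge> \<psi> y + ereal (inner (egrad \<psi> y) (x - y))"
proof (cases "x \<in> edom \<psi>")
  case False
  then show ?thesis by (simp add: edom_def)
next
  case x: True
  define p where "p w = real_of_ereal (\<psi> w)" for w
  define F where "F t = p (y + t *\<^sub>R (x - y))" for t
  have p: "\<psi> w = ereal (p w)" if "w \<in> edom \<psi>" for w
    using smooth_penalty_finite[OF \<psi> that] by (simp add: p_def)
  have slope: "(F t - F 0) / t \<le> p x - p y" if t: "0 < t" "t < 1" for t
  proof -
    have "\<psi> ((1 - t) *\<^sub>R y + t *\<^sub>R x) \<le> ereal (1 - t) * \<psi> y + ereal t * \<psi> x"
      using \<psi> t unfolding smooth_penalty_def convex_fun_def by blast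
    also have "\<dots> = ereal ((1 - t) * p y + t * p x)" by (simp add: p x y)
    finally have le: "\<psi> ((1 - t) *\<^sub>R y + t *\<^sub>R x) \<le> ereal ((1 - t) * p y + t * p x)" .
    then have "(1 - t) *\<^sub>R y + t *\<^sub>R x \<in> edom \<psi>" by (auto simp: edom_def)
    moreover have eq: "(1 - t) *\<^sub>R y + t *\<^sub>R x = y + t *\<^sub>R (x - y)"
      by (simp add: algebra_simps)
    ultimately have "F t \<le> (1 - t) * p y + t * p x" using le by (simp add: p F_def)
    moreover have "F 0 = p y" by (simp add: F_def)
    ultimately show ?thesis using t by (subst pos_divide_le_eq) (auto simp: algebra_simps)
  qed
  have "(p has_derivative (\<lambda>h. inner h (egrad \<psi> y))) (at (y + 0 *\<^sub>R (x - y)))"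
    using smooth_penalty_has_egrad[OF \<psi> y] by (simp add: has_egrad_def gderiv_def p_def[abs_def])
  then have "(F has_derivative (\<lambda>t. inner (t *\<^sub>R (x - y)) (egrad \<psi> y))) (at 0)"
    unfolding F_def by (rule has_derivative_compose[rotated]) (auto intro!: derivative_eq_intros)
  then have "(F has_field_derivative inner (x - y) (egrad \<psi> y)) (at 0)"
    by (simp add: has_field_derivative_def mult.commute[of _ "inner (x - y) (egrad \<psi> y)"]
        mult_commute_abs)
  then have "((\<lambda>t. (F t - F 0) / t) \<longlongrightarrow> inner (x - y) (egrad \<psi> y)) (at_right 0)"
    unfolding DERIV_def by (auto intro: tendsto_within_subset)
  moreover have "\<forall>\<^sub>F t in at_right 0. (F t - F 0) / t \<le> p x - p y"
    by (rule eventually_at_rightI[of 0 1]) (auto intro: slope)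
  ultimately have "inner (x - y) (egrad \<psi> y) \<le> p x - p y"
    by (rule tendsto_upperbound) simp
  then show ?thesis by (simp add: p x y inner_commute)
qed

lemma smooth_penalty_nonneg: "smooth_penalty \<psi> \<Longrightarrow> \<psi> w \<ge> 0"
  using smooth_penalty_tangent[OF _ smooth_penalty_zero_mem, of \<psi> w]
  by (simp add: smooth_penalty_def)

text \<open>On the compact unit sphere the quadratic form of the Hessian at the origin has a positive
  minimum \<open>2 * \<sigma>\<close>; by continuity the Hessian stays within \<open>\<sigma>\<close> of that value on a whole ball. The mean value theorem turns this into strong
  monotonicity and Lipschitz continuity of the gradient.\<close>
lemma smooth_penalty_local:
  fixes \<psi> :: "'a::euclidean_space \<Rightarrow> ereal"
  assumes \<psi>: "smooth_penalty \<psi>"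
  obtains \<rho> \<sigma> L where "\<rho> > 0" "\<sigma> > 0" "L > 0" "ball 0 \<rho> \<subseteq> edom \<psi>"
    "\<And>x y. x \<in> ball 0 \<rho> \<Longrightarrow> y \<in> ball 0 \<rho> \<Longrightarrow>
       inner (egrad \<psi> x - egrad \<psi> y) (x - y) \<ge> \<sigma> * (norm (x - y))\<^sup>2"
    "\<And>x y. x \<in> ball 0 \<rho> \<Longrightarrow> y \<in> ball 0 \<rho> \<Longrightarrow>
       norm (egrad \<psi> x - egrad \<psi> y) \<le> L * norm (x - y)"
proof -
  let ?G = "egrad \<psi>"
  have op: "open (edom \<psi>)" using \<psi> by (simp add: smooth_penalty_def)
  from \<psi> obtain H :: "'a \<Rightarrow> 'a \<Rightarrow>\<^sub>L 'a" where contH: "continuous_on (edom \<psi>) H"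
    and H: "\<And>w. w \<in> edom \<psi> \<Longrightarrow> (?G has_derivative blinfun_apply (H w)) (at w)"
    and pd: "\<And>w d. w \<in> edom \<psi> \<Longrightarrow> d \<noteq> 0 \<Longrightarrow> 0 < inner d (blinfun_apply (H w) d)"
    unfolding smooth_penalty_def twice_cont_diff_pd_def by (auto simp: interior_open)
  have z: "0 \<in> edom \<psi>" using \<psi> by (rule smooth_penalty_zero_mem)
  have "\<exists>s\<in>sphere 0 1. \<forall>d\<in>sphere 0 1. inner s (H 0 s) \<le> inner d (H 0 d)"
    by (rule continuous_attains_inf) (auto intro!: continuous_intros)
  then obtain s :: 'a where s: "norm s = 1" "\<And>d. norm d = 1 \<Longrightarrow> inner s (H 0 s) \<le> inner d (H 0 d)"
    by auto
  define \<sigma> where "\<sigma> = inner s (H 0 s) / 2"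
  have \<sigma>: "\<sigma> > 0" using pd[OF z, of s] s(1) by (cases "s = 0") (auto simp: \<sigma>_def)
  have unit: "2 * \<sigma> * (norm d)\<^sup>2 \<le> inner d (H 0 d)" for d
  proof (cases "d = 0")
    case False
    then have "2 * \<sigma> \<le> inner (d /\<^sub>R norm d) (H 0 (d /\<^sub>R norm d))"
      unfolding \<sigma>_def using s(2)[of "d /\<^sub>R norm d"] by simp
    then show ?thesis using False
      by (simp add: blinfun.scaleR_right field_simps power2_eq_square)
  qed auto
  have "continuous (at 0) H" using contH op z continuous_on_eq_continuous_at by blast
  then obtain \<rho>1 where \<rho>1: "\<rho>1 > 0" "\<And>w. norm w < \<rho>1 \<Longrightarrow> norm (H w - H 0) < \<sigma>"
    unfolding continuous_at_eps_delta using \<sigma> by (auto simp: dist_norm)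
  from op z obtain \<rho>2 where \<rho>2: "\<rho>2 > 0" "ball 0 \<rho>2 \<subseteq> edom \<psi>"
    by (auto simp: open_contains_ball)
  define \<rho> where "\<rho> = min \<rho>1 \<rho>2"
  define L where "L = norm (H 0) + \<sigma>"
  have sub: "ball 0 \<rho> \<subseteq> edom \<psi>" using \<rho>2 by (auto simp: \<rho>_def)
  have close: "norm (H w - H 0) < \<sigma>" if "w \<in> ball 0 \<rho>" for w
    using that \<rho>1 by (auto simp: \<rho>_def)
  have lip: "norm (?G x - ?G y) \<le> L * norm (x - y)" if "x \<in> ball 0 \<rho>" "y \<in> ball 0 \<rho>" for x y
  proof (rule differentiable_bound[OF convex_ball _ _ that, of ?G "\<lambda>w. blinfun_apply (H w)"])
    fix w :: 'a assume w: "w \<in> ball 0 \<rho>"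
    show "(?G has_derivative blinfun_apply (H w)) (at w within ball 0 \<rho>)"
      using H w sub by (blast intro: has_derivative_at_withinI)
    show "onorm (blinfun_apply (H w)) \<le> L"
      using close[OF w] norm_triangle_ineq2[of "H w" "H 0"] by (simp add: L_def norm_blinfun.rep_eq[symmetric])
  qed
  have mono: "inner (?G x - ?G y) (x - y) \<ge> \<sigma> * (norm (x - y))\<^sup>2"
    if x: "x \<in> ball 0 \<rho>" and y: "y \<in> ball 0 \<rho>" for x y
  proof -
    define d where "d = x - y"
    have seg: "y + t *\<^sub>R d \<in> ball 0 \<rho>" if "0 \<le> t" "t \<le> 1" for t
    proof -
      have "y + t *\<^sub>R d = (1 - t) *\<^sub>R y + t *\<^sub>R x" by (simp add: d_def algebra_simps)
      then show ?thesis using convexD[OF convex_ball y x, of "1 - t" t] that by simp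
    qed
    have "\<exists>t\<in>{0<..<1}. inner (?G (y + 1 *\<^sub>R d)) d - inner (?G (y + 0 *\<^sub>R d)) d
        = inner (H (y + t *\<^sub>R d) ((1 - 0) *\<^sub>R d)) d"
    proof (rule mvt_simple)
      fix t :: real assume t: "0 \<le> t" "t \<le> 1"
      have "(?G has_derivative blinfun_apply (H (y + t *\<^sub>R d))) (at (y + t *\<^sub>R d))"
        using H seg[OF t] sub by blast
      then have "((\<lambda>t. ?G (y + t *\<^sub>R d)) has_derivative (\<lambda>h. H (y + t *\<^sub>R d) (h *\<^sub>R d))) (at t)"
        by (rule has_derivative_compose[rotated]) (auto intro!: derivative_eq_intros)
      then show "((\<lambda>t. inner (?G (y + t *\<^sub>R d)) d) has_derivative
          (\<lambda>h. inner (H (y + t *\<^sub>R d) (h *\<^sub>R d)) d)) (at t within {0..1})"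
        by (rule has_derivative_at_withinI[OF has_derivative_inner_left])
    qed simp
    then obtain t where t: "0 < t" "t < 1"
      and "inner (?G (y + d)) d - inner (?G y) d = inner (H (y + t *\<^sub>R d) d) d"
      by auto
    moreover have "y + d = x" by (simp add: d_def)
    ultimately have eq: "inner (?G x - ?G y) d = inner d (H (y + t *\<^sub>R d) d)"
      by (simp add: inner_diff_left inner_diff_right inner_commute)
    let ?E = "H (y + t *\<^sub>R d) - H 0"
    have "\<bar>inner d (?E d)\<bar> \<le> norm d * norm (?E d)" by (rule Cauchy_Schwarz_ineq2)
    also have "\<dots> \<le> norm d * (\<sigma> * norm d)"
      using close[OF seg[of t]] t norm_blinfun[of ?E d]
      by (intro mult_left_mono order_trans[OF norm_blinfun] mult_right_mono) auto
    finally have "\<bar>inner d (?E d)\<bar> \<le> \<sigma> * (norm d)\<^sup>2" by (simp add: power2_eq_square mult_ac)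
    moreover have "inner d (H (y + t *\<^sub>R d) d) = inner d (H 0 d) + inner d (?E d)"
      by (simp add: blinfun.diff_left inner_diff_right)
    ultimately show ?thesis using unit[of d] eq by (simp add: d_def abs_le_iff)
  qed
  show thesis
    by (rule that[OF _ \<sigma> _ sub mono lip]) (use \<rho>1 \<rho>2 \<sigma> in \<open>auto simp: \<rho>_def L_def add_nonneg_pos\<close>)
qed

text \<open>By strong monotonicity the tangent at the point \<open>x\<close> of norm \<open>\<eta> / 2\<close> on the ray through \<open>w\<close> has
  slope at least \<open>\<sigma> * \<eta> / 2\<close> in the direction of \<open>w\<close>, and \<open>\<psi>\<close> lies above that tangent. As \<open>w - x\<close>
  covers at least half of the way to \<open>w\<close>, half of the slope is a valid growth rate from the origin.
  The gradient bound follows because the tangent at \<open>w\<close> must lie below \<open>\<psi> 0 = 0\<close>.\<close>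
lemma smooth_penalty_growth:
  fixes \<psi> :: "'a::euclidean_space \<Rightarrow> ereal"
  assumes \<psi>: "smooth_penalty \<psi>" and \<delta>: "\<delta> > 0"
  obtains c where "c > 0" "\<And>w. norm w \<ge> \<delta> \<Longrightarrow> \<psi> w \<ge> ereal (c * norm w)"
    "\<And>w. w \<in> edom \<psi> \<Longrightarrow> norm w \<ge> \<delta> \<Longrightarrow> norm (egrad \<psi> w) \<ge> c"
proof -
  from smooth_penalty_local[OF \<psi>] obtain \<rho> \<sigma> where \<rho>: "\<rho> > 0" "\<sigma> > 0"
    and sub: "ball 0 \<rho> \<subseteq> edom \<psi>"
    and mono: "\<And>x y. x \<in> ball 0 \<rho> \<Longrightarrow> y \<in> ball 0 \<rho> \<Longrightarrow>
       inner (egrad \<psi> x - egrad \<psi> y) (x - y) \<ge> \<sigma> * (norm (x - y))\<^sup>2"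
    by metis
  have g0: "egrad \<psi> 0 = 0" using \<psi> by (simp add: smooth_penalty_def)
  \<comment> \<open>Shrinking the radius below \<open>\<rho>\<close> puts the sphere of radius \<open>\<eta> / 2\<close> into the ball of strong
    monotonicity.\<close>
  define \<eta> where "\<eta> = min \<delta> (\<rho> / 2)"
  have \<eta>: "0 < \<eta>" "\<eta> \<le> \<delta>" "\<eta> < \<rho>" using \<delta> \<rho> by (auto simp: \<eta>_def)
  define c where "c = \<sigma> * \<eta> / 4"
  have c: "c > 0" using \<rho> \<eta> by (simp add: c_def)
  have grow: "\<psi> w \<ge> ereal (c * norm w)" if w: "norm w \<ge> \<delta>" for w
  proof -
    have nw: "norm w > 0" "norm w \<ge> \<eta>" using w \<delta> \<eta> by auto
    define s where "s = \<eta> / (2 * norm w)"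
    define x where "x = s *\<^sub>R w"
    have s: "0 < s" "s \<le> 1 / 2" using nw \<eta> by (auto simp: s_def field_simps)
    have nx: "norm x = \<eta> / 2" using nw \<eta> by (simp add: x_def s_def)
    then have xb: "x \<in> ball 0 \<rho>" using \<eta> by simp
    have "\<sigma> * (\<eta> / 2)\<^sup>2 \<le> inner (egrad \<psi> x) x"
      using mono[OF xb, of 0] \<rho> nx by (simp add: g0)
    also have "\<dots> = s * inner (egrad \<psi> x) w" by (simp add: x_def)
    finally have "\<sigma> * (\<eta> / 2)\<^sup>2 / s \<le> inner (egrad \<psi> x) w"
      using s by (simp add: pos_divide_le_eq mult.commute)
    moreover have "\<sigma> * (\<eta> / 2)\<^sup>2 / s = 2 * (c * norm w)"
      using nw \<eta> by (simp add: s_def c_def power2_eq_square field_simps)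
    ultimately have A: "2 * (c * norm w) \<le> inner (egrad \<psi> x) w" by simp
    have "inner (egrad \<psi> x) (w - x) = (1 - s) * inner (egrad \<psi> x) w"
      by (simp add: x_def inner_diff_right algebra_simps)
    moreover have "1 / 2 * (2 * (c * norm w)) \<le> (1 - s) * inner (egrad \<psi> x) w"
      using A s c nw by (intro mult_mono) auto
    ultimately have "ereal (c * norm w) \<le> ereal (inner (egrad \<psi> x) (w - x))" by simp
    also have "\<dots> \<le> \<psi> x + ereal (inner (egrad \<psi> x) (w - x))"
      using smooth_penalty_nonneg[OF \<psi>, of x] add_right_mono[of 0 "\<psi> x"] by simp
    also have "\<dots> \<le> \<psi> w" by (rule smooth_penalty_tangent[OF \<psi>]) (use xb sub in auto)
    finally show ?thesis .
  qed
  have gradgrow: "norm (egrad \<psi> w) \<ge> c" if w: "w \<in> edom \<psi>" "norm w \<ge> \<delta>" for w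
  proof -
    have nw: "norm w > 0" using w \<delta> by auto
    have "\<psi> w + ereal (inner (egrad \<psi> w) (0 - w)) \<le> \<psi> 0"
      by (rule smooth_penalty_tangent[OF \<psi> w(1)])
    then have "real_of_ereal (\<psi> w) \<le> inner (egrad \<psi> w) w"
      using \<psi> by (subst (asm) smooth_penalty_finite[OF \<psi> w(1), symmetric])
        (simp add: smooth_penalty_def)
    moreover have "c * norm w \<le> real_of_ereal (\<psi> w)"
      using grow[OF w(2)] by (subst (asm) smooth_penalty_finite[OF \<psi> w(1), symmetric]) simp
    ultimately have "c * norm w \<le> norm (egrad \<psi> w) * norm w"
      using norm_cauchy_schwarz[of "egrad \<psi> w" w] by linarith
    then show ?thesis using nw by simp
  qed
  show thesis by (rule that[OF c grow gradgrow])
qed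


section \<open>The envelope around a critical pair\<close>

text \<open>A two-sided quadratic estimate is what the comparison of minimisers yields for an envelope.\<close>
lemma GDERIV_quadratic_remainder:
  fixes p :: "'a::real_inner \<Rightarrow> real"
  assumes "d > 0"
    and le: "\<And>y. dist y x < d \<Longrightarrow> \<bar>p y - p x - inner g (y - x)\<bar> \<le> K * (norm (y - x))\<^sup>2"
  shows "GDERIV p x :> g"
  unfolding gderiv_def has_derivative_iff_norm
proof
  show "bounded_linear (\<lambda>h. inner h g)" by (rule bounded_linear_inner_left)
  have "((\<lambda>y. K * norm (y - x)) \<longlongrightarrow> K * norm (x - x)) (at x)" by (intro tendsto_intros)
  then have "((\<lambda>y. K * norm (y - x)) \<longlongrightarrow> 0) (at x)" by simp
  moreover have "\<forall>\<^sub>F y in at x. norm (norm (p y - p x - inner (y - x) g) / norm (y - x)) \<le> K * norm (y - x)"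
    unfolding eventually_at
  proof (intro exI[of _ d] conjI ballI impI)
    fix y assume y: "y \<noteq> x \<and> dist y x < d"
    then have "\<bar>p y - p x - inner (y - x) g\<bar> \<le> K * (norm (y - x))\<^sup>2"
      using le[of y] by (simp add: inner_commute)
    then show "norm (norm (p y - p x - inner (y - x) g) / norm (y - x)) \<le> K * norm (y - x)"
      using y by (simp add: pos_divide_le_eq power2_eq_square mult.assoc)
  qed (use \<open>d > 0\<close> in auto)
  ultimately show "((\<lambda>y. norm (p y - p x - inner (y - x) g) / norm (y - x)) \<longlongrightarrow> 0) (at x)"
    by (rule Lim_null_comparison[rotated])
qed

text \<open>Envelope theorem with explicit constants. Assumption \<open>far\<close> confines the minimisers for the base
  point \<open>v\<close> to the \<open>\<delta>\<close>-ball around \<open>v\<close>, where \<open>\<psi>\<close> is finite and smooth, so a minimiser \<open>P v\<close> exists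
  and is critical. Subtracting the critical equations of two base points, the strong monotonicity
  \<open>\<sigma>\<close> of the gradient of \<open>\<psi>\<close> absorbs the hypomonotonicity \<open>lam * r\<close> of \<open>g\<close>; hence \<open>v - P v\<close> is
  Lipschitz in \<open>v\<close>, and \<open>P vb = zb\<close> because both are critical for \<open>vb\<close>. Using the minimiser of one
  base point as a competitor for another bounds the increments of the envelope from both sides by
  increments of \<open>\<psi>\<close>.

  The factor 3 leaves room for \<open>v' - P v\<close> and for \<open>P v - zb\<close> when \<open>v\<close> and \<open>v'\<close> range over the
  \<open>\<delta>\<close>-ball around \<open>vb\<close>.\<close>
lemma envelope_lipschitz_diff:
  fixes \<psi> :: "'a::euclidean_space \<Rightarrow> ereal" and f :: "'a \<Rightarrow> real" and g :: "'a \<Rightarrow> 'a"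
    and lam :: real and zb vb :: 'a
  defines "e \<equiv> envelope lam \<psi> (\<lambda>z. ereal (f z))"
  assumes \<psi>: "smooth_penalty \<psi>"
    and \<sigma>: "\<sigma> > 0" and L: "L > 0" and sub: "ball 0 \<rho> \<subseteq> edom \<psi>"
    and mono: "\<And>x y. x \<in> ball 0 \<rho> \<Longrightarrow> y \<in> ball 0 \<rho> \<Longrightarrow>
       inner (egrad \<psi> x - egrad \<psi> y) (x - y) \<ge> \<sigma> * (norm (x - y))\<^sup>2"
    and lip: "\<And>x y. x \<in> ball 0 \<rho> \<Longrightarrow> y \<in> ball 0 \<rho> \<Longrightarrow>
       norm (egrad \<psi> x - egrad \<psi> y) \<le> L * norm (x - y)"
    and \<delta>: "0 < \<delta>" "3 * \<delta> < \<rho>"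
    and lam: "lam > 0" "r \<ge> 0" "4 * (lam * r) \<le> \<sigma>"
    and gf: "\<And>z. GDERIV f z :> g z"
    and hypo: "\<And>z z'. z \<in> ball zb (3 * \<delta>) \<Longrightarrow> z' \<in> ball zb (3 * \<delta>) \<Longrightarrow>
       f z' \<ge> f z + inner (g z) (z' - z) - r / 2 * (norm (z' - z))\<^sup>2"
    and far: "\<And>v z. v \<in> ball vb \<delta> \<Longrightarrow> norm (v - z) \<ge> \<delta> \<Longrightarrow>
       ereal (f v) < ereal (f z) + ereal (1 / lam) * \<psi> (v - z)"
    and near: "norm (vb - zb) < \<delta>"
    and crit: "g zb = (1 / lam) *\<^sub>R egrad \<psi> (vb - zb)"
  shows "lipschitz_diff_around e vb \<and> has_egrad e vb (g zb)"
proof -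
  let ?G = "egrad \<psi>"
  define p where "p w = real_of_ereal (\<psi> w)" for w
  define Q where "Q v z = f z + 1 / lam * p (v - z)" for v z
  have p: "\<psi> w = ereal (p w)" if "norm w < \<rho>" for w
    using smooth_penalty_finite[OF \<psi>, of w] that sub by (auto simp: p_def)
  have Q: "ereal (Q v z) = ereal (f z) + ereal (1 / lam) * \<psi> (v - z)" if "norm (v - z) < \<rho>" for v z
    by (simp add: p that Q_def)
  have dp: "GDERIV p w :> ?G w" if "norm w < \<rho>" for w
    using smooth_penalty_has_egrad[OF \<psi>, of w] that sub
    by (auto simp: has_egrad_def p_def[abs_def])
  have tangent: "p a + inner (?G a) (b - a) \<le> p b" if "norm a < \<rho>" "norm b < \<rho>" for a b
    using smooth_penalty_tangent[OF \<psi>, of a b] that sub by (auto simp: p)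
  have e_le: "e v \<le> ereal (Q v z)" if "norm (v - z) < \<rho>" for v z
    unfolding Q[OF that] e_def envelope_def by (rule INF_lower) simp
  have "\<exists>z. norm (v - z) < \<delta> \<and> e v = ereal (Q v z) \<and> g z = (1 / lam) *\<^sub>R ?G (v - z)"
    if v: "v \<in> ball vb \<delta>" for v
  proof -
    have dQ: "((\<lambda>z. Q v z) has_derivative (\<lambda>h. inner h (g z - (1 / lam) *\<^sub>R ?G (v - z)))) (at z)"
      if "norm (v - z) < \<rho>" for z
    proof -
      have "((\<lambda>z. p (v - z)) has_derivative (\<lambda>h. inner (- h) (?G (v - z)))) (at z)"
        using dp[OF that, unfolded gderiv_def]
        by (rule has_derivative_compose[rotated, where f = "\<lambda>z. v - z"]) (auto intro!: derivative_eq_intros)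
      then show ?thesis unfolding Q_def
        using lam by (auto intro!: derivative_eq_intros gf[unfolded gderiv_def] simp: inner_diff_right)
    qed
    have "continuous_on (cball v \<delta>) (\<lambda>z. Q v z)"
    proof (intro continuous_at_imp_continuous_on ballI)
      fix z assume "z \<in> cball v \<delta>"
      then have "norm (v - z) < \<rho>" using \<delta> by (simp add: dist_norm)
      then show "isCont (Q v) z" using dQ has_derivative_continuous by blast
    qed
    then obtain z where z: "z \<in> cball v \<delta>" "\<And>z'. z' \<in> cball v \<delta> \<Longrightarrow> Q v z \<le> Q v z'"
      using continuous_attains_inf[of "cball v \<delta>" "Q v"] \<delta> by auto
    have z\<rho>: "norm (v - z) < \<rho>" using z \<delta> by (simp add: dist_norm)
    have "p 0 = 0" using \<psi> by (simp add: p_def smooth_penalty_def)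
    then have Qv: "Q v z \<le> f v" using z(2)[of v] \<delta> by (simp add: Q_def)
    have in_ball: "norm (v - z) < \<delta>"
    proof (rule ccontr)
      assume "\<not> norm (v - z) < \<delta>"
      then have "ereal (f v) < ereal (Q v z)" using far[OF v, of z] by (simp add: Q z\<rho>)
      then show False using Qv by simp
    qed
    have "ereal (Q v z) \<le> ereal (f z') + ereal (1 / lam) * \<psi> (v - z')" for z'
    proof (cases "norm (v - z') \<le> \<delta>")
      case True
      then have "norm (v - z') < \<rho>" using \<delta> by simp
      from Q[OF this] have "ereal (f z') + ereal (1 / lam) * \<psi> (v - z') = ereal (Q v z')" by simp
      moreover have "Q v z \<le> Q v z'" using True by (intro z(2)) (simp add: dist_norm)
      ultimately show ?thesis by simp
    next
      case False
      then show ?thesis using far[OF v, of z'] Qv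
        by (meson ereal_less_eq(3) less_imp_le linear order_trans)
    qed
    then have "e v \<ge> ereal (Q v z)" unfolding e_def envelope_def by (intro INF_greatest)
    then have ev: "e v = ereal (Q v z)" using e_le[OF z\<rho>] by (rule antisym[rotated])
    have "(\<lambda>h. inner h (g z - (1 / lam) *\<^sub>R ?G (v - z))) = (\<lambda>h. 0)"
      by (rule differential_zero_maxmin[of z "ball v \<delta>" "Q v"])
        (use in_ball z dQ[OF z\<rho>] in \<open>auto simp: dist_norm\<close>)
    then have "inner (g z - (1 / lam) *\<^sub>R ?G (v - z)) (g z - (1 / lam) *\<^sub>R ?G (v - z)) = 0"
      by meson
    then show ?thesis using in_ball ev by auto
  qed
  then obtain P where P: "\<And>v. v \<in> ball vb \<delta> \<Longrightarrow> norm (v - P v) < \<delta>"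
    and eP: "\<And>v. v \<in> ball vb \<delta> \<Longrightarrow> e v = ereal (Q v (P v))"
    and critP: "\<And>v. v \<in> ball vb \<delta> \<Longrightarrow> g (P v) = (1 / lam) *\<^sub>R ?G (v - P v)"
    by metis
  define K where "K = 2 * L / \<sigma> + 1"
  have K: "K \<ge> 1" using \<sigma> L by (simp add: K_def)
  have disp: "norm ((v - z) - (v' - z')) \<le> K * norm (v - v')"
    if v: "v \<in> ball vb \<delta>" "norm (v - z) < \<delta>" "g z = (1 / lam) *\<^sub>R ?G (v - z)"
      and v': "v' \<in> ball vb \<delta>" "norm (v' - z') < \<delta>" "g z' = (1 / lam) *\<^sub>R ?G (v' - z')"
    for v z v' z'
  proof -
    define a where "a = v - z"
    define b where "b = v' - z'"
    define s where "s = norm (a - b)"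
    define d where "d = norm (v - v')"
    have zball: "z \<in> ball zb (3 * \<delta>)" if "v \<in> ball vb \<delta>" "norm (v - z) < \<delta>" for v z
    proof -
      have "zb - z = (zb - vb) + (vb - v) + (v - z)" by simp
      then have "norm (zb - z) \<le> norm (zb - vb) + norm (vb - v) + norm (v - z)"
        by (metis norm_triangle_mono order_refl norm_triangle_ineq)
      then show ?thesis using that near by (simp add: dist_norm norm_minus_commute)
    qed
    note zz = zball[OF v(1,2)] zball[OF v'(1,2)]
    have "norm a < \<rho>" "norm b < \<rho>" using v v' \<delta> by (auto simp: a_def b_def)
    then have ab: "a \<in> ball 0 \<rho>" "b \<in> ball 0 \<rho>" by auto
    have "inner (g z - g z') (z - z') \<ge> - r * (norm (z - z'))\<^sup>2"
      using hypo[OF zz] hypo[OF zz(2) zz(1)]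
      by (simp add: inner_diff_left inner_diff_right norm_minus_commute)
    then have "lam * (- r * (norm (z - z'))\<^sup>2) \<le> lam * inner (g z - g z') (z - z')"
      using lam by (intro mult_left_mono) auto
    also have "\<dots> = inner (?G a - ?G b) (z - z')"
      using lam by (simp add: v v' a_def b_def flip: scaleR_diff_right)
    also have "z - z' = (v - v') - (a - b)" by (simp add: a_def b_def)
    also have "inner (?G a - ?G b) ((v - v') - (a - b))
        = inner (?G a - ?G b) (v - v') - inner (?G a - ?G b) (a - b)"
      by (rule inner_diff_right)
    also have "\<dots> \<le> L * s * d - \<sigma> * s\<^sup>2"
    proof (rule diff_mono)
      have "inner (?G a - ?G b) (v - v') \<le> norm (?G a - ?G b) * norm (v - v')"
        by (rule norm_cauchy_schwarz)
      also have "\<dots> \<le> L * s * d" unfolding s_def d_def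
        by (intro mult_right_mono lip ab) auto
      finally show "inner (?G a - ?G b) (v - v') \<le> L * s * d" .
    qed (use mono[OF ab] in \<open>simp add: s_def\<close>)
    finally have 1: "\<sigma> * s\<^sup>2 \<le> L * s * d + lam * r * (norm (z - z'))\<^sup>2"
      by (simp add: a_def b_def)
    have "norm (z - z') \<le> s + d"
      using norm_triangle_ineq4[of "v - v'" "a - b"] by (simp add: a_def b_def s_def d_def)
    then have "(norm (z - z'))\<^sup>2 \<le> (s + d)\<^sup>2" by (rule power_mono) simp
    also have "\<dots> \<le> 2 * s\<^sup>2 + 2 * d\<^sup>2"
      using zero_le_power2[of "s - d"] by (simp add: power2_eq_square algebra_simps)
    finally have "lam * r * (norm (z - z'))\<^sup>2 \<le> \<sigma> / 4 * (2 * s\<^sup>2 + 2 * d\<^sup>2)"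
      using lam \<sigma> by (intro mult_mono) auto
    with 1 have 2: "\<sigma> / 2 * s\<^sup>2 \<le> L * s * d + \<sigma> / 2 * d\<^sup>2" by (simp add: algebra_simps)
    \<comment> \<open>\<open>K\<close> is chosen so that for \<open>d \<le> s\<close> the right-hand side of the previous inequality is at most
      \<open>\<sigma> / 2 * (s * (K * d))\<close>.\<close>
    have "s \<le> K * d"
    proof (rule ccontr)
      assume "\<not> s \<le> K * d"
      then have s: "s > K * d" by simp
      have d0: "d \<ge> 0" by (simp add: d_def)
      then have sd: "s \<ge> d" "s > 0" using s K mult_right_mono[of 1 K d] by auto
      have "L * s * d + \<sigma> / 2 * d\<^sup>2 \<le> L * s * d + \<sigma> / 2 * (s * d)"
        using sd d0 \<sigma> by (simp add: power2_eq_square mult_right_mono)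
      also have "\<dots> = \<sigma> / 2 * (s * (K * d))" using \<sigma> by (simp add: K_def field_simps)
      also have "\<dots> < \<sigma> / 2 * (s * s)" using s sd \<sigma> by (intro mult_strict_left_mono) auto
      finally show False using 2 by (simp add: power2_eq_square)
    qed
    then show ?thesis by (simp add: s_def a_def b_def d_def)
  qed
  have vb: "vb \<in> ball vb \<delta>" using \<delta> by simp
  have Pvb: "P vb = zb"
    using disp[OF vb P[OF vb] critP[OF vb] vb near crit] by simp
  define D where "D v = (1 / lam) *\<^sub>R ?G (v - P v)" for v
  have P\<rho>: "norm (v' - P v) < \<rho>" if "v \<in> ball vb \<delta>" "v' \<in> ball vb \<delta>" for v v'
  proof -
    have "v' - P v = (v' - vb) + (vb - v) + (v - P v)" by simp
    then have "norm (v' - P v) \<le> norm (v' - vb) + norm (vb - v) + norm (v - P v)"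
      by (metis norm_triangle_mono order_refl norm_triangle_ineq)
    then show ?thesis using that P[of v] \<delta> by (simp add: dist_norm norm_minus_commute)
  qed
  define E where "E v = real_of_ereal (e v)" for v
  have E: "e v = ereal (E v)" "E v = Q v (P v)" if "v \<in> ball vb \<delta>" for v
    by (simp_all add: E_def eP[OF that])
  have E_le: "E v' \<le> Q v' (P v)" if "v \<in> ball vb \<delta>" "v' \<in> ball vb \<delta>" for v v'
    using e_le[OF P\<rho>[OF that]] E[OF that(2)] by simp
  have Pdiff: "norm (P v - P v') \<le> (K + 1) * norm (v - v')"
    if "v \<in> ball vb \<delta>" "v' \<in> ball vb \<delta>" for v v'
  proof -
    have "P v - P v' = (v - v') - ((v - P v) - (v' - P v'))" by simp
    then have "norm (P v - P v') \<le> norm (v - v') + norm ((v - P v) - (v' - P v'))"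
      by (metis norm_triangle_ineq4)
    also have "\<dots> \<le> norm (v - v') + K * norm (v - v')"
      using that P critP by (intro add_left_mono disp) auto
    finally show ?thesis by (simp add: algebra_simps)
  qed
  have quad: "\<bar>E v' - E v - inner (D v) (v' - v)\<bar> \<le> 1 / lam * (L * (K + 1)) * (norm (v' - v))\<^sup>2"
    if v: "v \<in> ball vb \<delta>" and v': "v' \<in> ball vb \<delta>" for v v'
  proof -
    let ?d = "v' - v"
    note n = P\<rho>[OF v v] P\<rho>[OF v v'] P\<rho>[OF v' v] P\<rho>[OF v' v']
    have CS: "\<bar>inner (?G a - ?G (v - P v)) ?d\<bar> \<le> L * (K + 1) * (norm ?d)\<^sup>2"
      if "norm a < \<rho>" "norm (a - (v - P v)) \<le> (K + 1) * norm ?d" for a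
    proof -
      have "\<bar>inner (?G a - ?G (v - P v)) ?d\<bar> \<le> norm (?G a - ?G (v - P v)) * norm ?d"
        by (rule Cauchy_Schwarz_ineq2)
      also have "\<dots> \<le> (L * ((K + 1) * norm ?d)) * norm ?d"
        using that n L by (intro mult_right_mono order_trans[OF lip] mult_left_mono) auto
      finally show ?thesis by (simp add: power2_eq_square mult.assoc)
    qed
    have D: "inner (D v) ?d = 1 / lam * inner (?G (v - P v)) ?d" by (simp add: D_def)
    have "E v' - E v \<le> 1 / lam * (p (v' - P v) - p (v - P v))"
      using E_le[OF v v'] E[OF v] by (simp add: Q_def algebra_simps)
    also have "\<dots> \<le> 1 / lam * inner (?G (v' - P v)) ?d"
      using tangent[OF n(2) n(1)] lam by (intro mult_left_mono) (auto simp: inner_diff_right)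
    finally have "E v' - E v - inner (D v) ?d \<le> 1 / lam * inner (?G (v' - P v) - ?G (v - P v)) ?d"
      unfolding D by (simp add: inner_diff_left algebra_simps)
    also have "\<dots> \<le> 1 / lam * (L * (K + 1) * (norm ?d)\<^sup>2)"
      using lam CS[OF n(2)] K mult_right_mono[of 1 "K + 1" "norm ?d"]
      by (intro mult_left_mono) (auto simp: abs_le_iff)
    finally have upper: "E v' - E v - inner (D v) ?d \<le> 1 / lam * (L * (K + 1) * (norm ?d)\<^sup>2)" .
    have "1 / lam * inner (?G (v - P v')) ?d \<le> 1 / lam * (p (v' - P v') - p (v - P v'))"
      using tangent[OF n(3) n(4)] lam by (intro mult_left_mono) auto
    also have "\<dots> \<le> E v' - E v"
      using E_le[OF v' v] E[OF v'] by (simp add: Q_def algebra_simps)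
    finally have "1 / lam * inner (?G (v - P v') - ?G (v - P v)) ?d \<le> E v' - E v - inner (D v) ?d"
      unfolding D by (simp add: inner_diff_left algebra_simps)
    moreover have "1 / lam * (- (L * (K + 1) * (norm ?d)\<^sup>2))
        \<le> 1 / lam * inner (?G (v - P v') - ?G (v - P v)) ?d"
      using lam CS[OF n(3)] Pdiff[OF v v']
      by (intro mult_left_mono) (auto simp: abs_le_iff norm_minus_commute)
    ultimately have "- (1 / lam * (L * (K + 1) * (norm ?d)\<^sup>2)) \<le> E v' - E v - inner (D v) ?d"
      by simp
    then show ?thesis using upper by (simp add: abs_le_iff mult.assoc)
  qed
  have grad: "has_egrad e v (D v)" if v: "v \<in> ball vb \<delta>" for v
  proof -
    from v obtain d where d: "d > 0" "ball v d \<subseteq> ball vb \<delta>"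
      by (meson open_ball open_contains_ball)
    have "\<bar>E y - E v - inner (D v) (y - v)\<bar> \<le> 1 / lam * (L * (K + 1)) * (norm (y - v))\<^sup>2"
      if "dist y v < d" for y
      by (rule quad[OF v]) (use d that in \<open>auto simp: dist_commute\<close>)
    with d(1) have "GDERIV E v :> D v" by (rule GDERIV_quadratic_remainder)
    moreover have "\<forall>\<^sub>F x in nhds v. ereal (E x) = e x"
      using eventually_nhds_in_open[OF open_ball v] by (rule eventually_mono) (simp add: E)
    ultimately show ?thesis by (rule has_egrad_cong[OF _ has_egrad_ereal, rotated])
  qed
  have "(1 / lam * (L * K))-lipschitz_on (ball vb \<delta>) (egrad e)"
  proof (rule lipschitz_onI)
    fix v v' assume v: "v \<in> ball vb \<delta>" "v' \<in> ball vb \<delta>"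
    have "norm (D v - D v') = 1 / lam * norm (?G (v - P v) - ?G (v' - P v'))"
      using lam by (simp add: D_def flip: scaleR_diff_right)
    also have "\<dots> \<le> 1 / lam * (L * (K * norm (v - v')))"
      using lam L v P critP P\<rho>
      by (intro mult_left_mono order_trans[OF lip] disp) auto
    finally show "dist (egrad e v) (egrad e v') \<le> 1 / lam * (L * K) * dist v v'"
      by (simp add: egrad_eq[OF grad[OF v(1)]] egrad_eq[OF grad[OF v(2)]] dist_norm mult.assoc)
  qed (use lam L K in auto)
  moreover have "\<forall>v\<in>ball vb \<delta>. ediff e v" using grad unfolding ediff_def by blast
  ultimately have "lipschitz_diff_around e vb"
    unfolding lipschitz_diff_around_def using \<delta>(1) by blast
  moreover have "D vb = g zb" by (simp add: D_def Pvb crit)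
  ultimately show ?thesis using grad[OF vb] by simp
qed

section \<open>Envelopes for all sufficiently small parameters\<close>

text \<open>The hypomonotonicity assumption is the prox-regularity inequality for a smooth function. The
  bound on \<open>lam\<close> is the same for all pairs \<open>(vb, zb)\<close>: uniform continuity of
  \<open>f\<close> and \<open>g\<close> on a ball around \<open>B\<close> gives one radius on which the inequality is available, and \<open>lam1\<close>
  gives one lower bound for all base points in that ball.\<close>
lemma envelope_lipschitz_diff_small_lam:
  fixes \<psi> :: "'a::euclidean_space \<Rightarrow> ereal" and f :: "'a \<Rightarrow> real" and g :: "'a \<Rightarrow> 'a"
    and \<epsilon> r lam1 :: real
  assumes \<psi>: "smooth_penalty \<psi>"
    and gf: "\<And>z. GDERIV f z :> g z" and cg: "continuous_on UNIV g"
    and lam1: "lam1 > 0"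
    and bound: "\<And>S. compact S \<Longrightarrow>
       \<exists>b. \<forall>v\<in>S. \<forall>z. ereal b \<le> ereal (f z) + ereal (1 / lam1) * \<psi> (v - z)"
    and "bounded B" and \<epsilon>: "\<epsilon> > 0" and r: "r \<ge> 0"
  obtains lam0 where "lam0 > 0"
    "\<And>lam vb zb. 0 < lam \<Longrightarrow> lam < lam0 \<Longrightarrow> zb \<in> B \<Longrightarrow> vb - zb \<in> edom \<psi> \<Longrightarrow>
       g zb = (1 / lam) *\<^sub>R egrad \<psi> (vb - zb) \<Longrightarrow>
       (\<And>z z'. norm (z - zb) < \<epsilon> \<Longrightarrow> norm (z' - zb) < \<epsilon> \<Longrightarrow> f z - f zb < \<epsilon> \<Longrightarrow>
          norm (g z - g zb) < \<epsilon> \<Longrightarrow>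
          f z' \<ge> f z + inner (g z) (z' - z) - r / 2 * (norm (z' - z))\<^sup>2) \<Longrightarrow>
       lipschitz_diff_around (envelope lam \<psi> (\<lambda>z. ereal (f z))) vb \<and>
       has_egrad (envelope lam \<psi> (\<lambda>z. ereal (f z))) vb (g zb)"
proof -
  obtain \<rho> \<sigma> L where \<rho>: "\<rho> > 0" and \<sigma>: "\<sigma> > 0" and L: "L > 0" and sub: "ball 0 \<rho> \<subseteq> edom \<psi>"
    and mono: "\<And>x y. x \<in> ball 0 \<rho> \<Longrightarrow> y \<in> ball 0 \<rho> \<Longrightarrow>
       inner (egrad \<psi> x - egrad \<psi> y) (x - y) \<ge> \<sigma> * (norm (x - y))\<^sup>2"
    and lip: "\<And>x y. x \<in> ball 0 \<rho> \<Longrightarrow> y \<in> ball 0 \<rho> \<Longrightarrow>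
       norm (egrad \<psi> x - egrad \<psi> y) \<le> L * norm (x - y)"
    using smooth_penalty_local[OF \<psi>] by blast
  have cf: "continuous_on S f" for S
    using gf unfolding gderiv_def
    by (meson continuous_at_imp_continuous_on has_derivative_continuous)
  have cgS: "continuous_on S g" for S using cg continuous_on_subset by blast
  obtain R where R: "R > 0" "\<And>z. z \<in> B \<Longrightarrow> norm z \<le> R"
    using \<open>bounded B\<close> by (auto simp: bounded_pos)
  have bdd: "bounded (f ` cball 0 (R + 2))" "bounded (g ` cball 0 (R + 2))"
    by (auto intro!: compact_imp_bounded compact_continuous_image cf cgS)
  from bdd(1) obtain M where M: "\<And>x. x \<in> cball 0 (R + 2) \<Longrightarrow> norm (f x) \<le> M"
    unfolding bounded_iff by blast
  from bdd(2) obtain G where G: "G > 0" "\<And>x. x \<in> cball 0 (R + 2) \<Longrightarrow> norm (g x) \<le> G"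
    unfolding bounded_pos by blast
  have "uniformly_continuous_on (cball 0 (R + 2)) f"
    by (intro compact_uniformly_continuous cf compact_cball)
  then obtain d1 where d1: "d1 > 0" "\<forall>x\<in>cball 0 (R + 2). \<forall>y\<in>cball 0 (R + 2).
      dist y x < d1 \<longrightarrow> dist (f y) (f x) < \<epsilon>"
    unfolding uniformly_continuous_on_def using \<epsilon> by blast
  have "uniformly_continuous_on (cball 0 (R + 2)) g"
    by (intro compact_uniformly_continuous cgS compact_cball)
  then obtain d2 where d2: "d2 > 0" "\<forall>x\<in>cball 0 (R + 2). \<forall>y\<in>cball 0 (R + 2).
      dist y x < d2 \<longrightarrow> dist (g y) (g x) < \<epsilon>"
    unfolding uniformly_continuous_on_def using \<epsilon> by blast
  define \<delta> where "\<delta> = min (min (min d1 d2) (min \<epsilon> 1)) \<rho> / 4"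
  have \<delta>: "\<delta> > 0" "3 * \<delta> < \<rho>" "3 * \<delta> < d1" "3 * \<delta> < d2" "3 * \<delta> < \<epsilon>" "3 * \<delta> < 1"
    using d1(1) d2(1) \<epsilon> \<rho> by (auto simp: \<delta>_def)
  obtain c where c: "c > 0" and grow: "\<And>w. norm w \<ge> \<delta> \<Longrightarrow> \<psi> w \<ge> ereal (c * norm w)"
    and ggrow: "\<And>w. w \<in> edom \<psi> \<Longrightarrow> norm w \<ge> \<delta> \<Longrightarrow> norm (egrad \<psi> w) \<ge> c"
    using smooth_penalty_growth[OF \<psi> \<delta>(1)] by blast
  obtain b where b: "\<And>v z. v \<in> cball 0 (R + 2) \<Longrightarrow>
      ereal b \<le> ereal (f z) + ereal (1 / lam1) * \<psi> (v - z)"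
    using bound[OF compact_cball, of 0 "R + 2"] by blast
  have c\<delta>: "c * \<delta> > 0" using c \<delta> by simp
  \<comment> \<open>For \<open>1 / lam > T\<close> the surplus \<open>(1 / lam - 1 / lam1) * (c * \<delta>)\<close> of the penalty outside the
    \<open>\<delta>\<close>-ball exceeds \<open>M - b\<close>, the gap between the values of \<open>f\<close> and the lower bound for \<open>lam1\<close>.\<close>
  define T where "T = 1 / lam1 + (\<bar>M - b\<bar> + 1) / (c * \<delta>)"
  have T: "T > 1 / lam1" using c\<delta> by (simp add: T_def)
  \<comment> \<open>\<open>1 / T\<close> is for \<open>far\<close>, \<open>c / G\<close> for \<open>near\<close>, and the last bound makes the penalty dominate \<open>r\<close>.\<close>
  define lam0 where "lam0 = min (1 / T) (min (c / G) (\<sigma> / (4 * (r + 1))))"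
  have T0: "T > 0" using T lam1 by (meson less_trans zero_less_divide_1_iff)
  have lam0: "lam0 > 0" using T0 c G \<sigma> r by (simp add: lam0_def)
  show thesis
  proof (rule that[OF lam0])
    fix lam vb zb
    assume lam: "0 < lam" "lam < lam0" and zb: "zb \<in> B" and dom: "vb - zb \<in> edom \<psi>"
      and crit: "g zb = (1 / lam) *\<^sub>R egrad \<psi> (vb - zb)"
      and hyp: "\<And>z z'. norm (z - zb) < \<epsilon> \<Longrightarrow> norm (z' - zb) < \<epsilon> \<Longrightarrow> f z - f zb < \<epsilon> \<Longrightarrow>
          norm (g z - g zb) < \<epsilon> \<Longrightarrow>
          f z' \<ge> f z + inner (g z) (z' - z) - r / 2 * (norm (z' - z))\<^sup>2"
    have lT: "T < 1 / lam" using lam T0 by (simp add: lam0_def field_simps)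
    have lG: "lam * G < c" using lam G by (simp add: lam0_def field_simps)
    have lr: "4 * (lam * r) \<le> \<sigma>"
    proof -
      have "lam * (4 * (r + 1)) < \<sigma>" using lam r by (simp add: lam0_def pos_less_divide_eq)
      then show ?thesis using lam by (simp add: algebra_simps)
    qed
    have zbR: "norm zb \<le> R" using R zb by simp
    have near: "norm (vb - zb) < \<delta>"
    proof (rule ccontr)
      assume "\<not> norm (vb - zb) < \<delta>"
      then have "c \<le> norm (egrad \<psi> (vb - zb))" using ggrow[OF dom] by simp
      also have "\<dots> = lam * norm (g zb)" using lam by (simp add: crit)
      also have "\<dots> \<le> lam * G" using G(2)[of zb] zbR lam by (intro mult_left_mono) auto
      finally show False using lG by simp
    qed
    have hypo: "f z' \<ge> f z + inner (g z) (z' - z) - r / 2 * (norm (z' - z))\<^sup>2"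
      if "z \<in> ball zb (3 * \<delta>)" "z' \<in> ball zb (3 * \<delta>)" for z z'
    proof (rule hyp)
      have n: "norm (z - zb) < 3 * \<delta>" "norm (z' - zb) < 3 * \<delta>"
        using that by (auto simp: dist_norm norm_minus_commute)
      then have z: "z \<in> cball 0 (R + 2)" "zb \<in> cball 0 (R + 2)"
        using zbR \<delta>(6) norm_triangle_sub[of z zb] by auto
      show "norm (z - zb) < \<epsilon>" "norm (z' - zb) < \<epsilon>" using n \<delta> by auto
      show "f z - f zb < \<epsilon>" "norm (g z - g zb) < \<epsilon>"
        using d1(2)[rule_format, OF z(2) z(1)] d2(2)[rule_format, OF z(2) z(1)] n \<delta>
        by (auto simp: dist_norm)
    qed
    have far: "ereal (f v) < ereal (f z) + ereal (1 / lam) * \<psi> (v - z)"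
      if v: "v \<in> ball vb \<delta>" and vz: "norm (v - z) \<ge> \<delta>" for v z
    proof (cases "\<psi> (v - z)")
      case (real a)
      have "v = (v - vb) + (vb - zb) + zb" by simp
      then have "norm v \<le> norm (v - vb) + norm (vb - zb) + norm zb"
        by (metis norm_triangle_mono order_refl norm_triangle_ineq)
      moreover have "norm (v - vb) < \<delta>" using v by (simp add: dist_norm norm_minus_commute)
      ultimately have vR: "v \<in> cball 0 (R + 2)" using near zbR \<delta>(6) by simp
      have "c * \<delta> \<le> c * norm (v - z)" using vz c by simp
      then have "c * \<delta> \<le> a" using grow[OF vz] real by simp
      have "M - b < (\<bar>M - b\<bar> + 1) / (c * \<delta>) * (c * \<delta>)" using c \<delta>(1) by simp
      also have "\<dots> = (T - 1 / lam1) * (c * \<delta>)" by (simp add: T_def)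
      also have "\<dots> \<le> (1 / lam - 1 / lam1) * a"
        using \<open>c * \<delta> \<le> a\<close> lT T c\<delta> by (intro mult_mono) auto
      also have "\<dots> = 1 / lam * a - 1 / lam1 * a" by (simp add: left_diff_distrib)
      finally have "M - b < 1 / lam * a - 1 / lam1 * a" .
      moreover have "b \<le> f z + 1 / lam1 * a" using b[OF vR, of z] real by simp
      moreover have "f v \<le> M" using M[OF vR] by simp
      ultimately show ?thesis using real by simp
    next
      case PInf
      then show ?thesis using lam by simp
    next
      case MInf
      then show ?thesis using \<psi> by (simp add: smooth_penalty_def)
    qed
    show "lipschitz_diff_around (envelope lam \<psi> (\<lambda>z. ereal (f z))) vb \<and>
        has_egrad (envelope lam \<psi> (\<lambda>z. ereal (f z))) vb (g zb)"
      by (rule envelope_lipschitz_diff[OF \<psi> \<sigma> L sub mono lip \<delta>(1,2) lam(1) r lr gf hypo far near crit])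
  qed
qed


section \<open>Restriction of separable functions to one block\<close>

lemma compact_uniform_lower_bound:
  fixes h :: "'a::metric_space \<Rightarrow> ereal"
  assumes "compact S" "\<And>x. x \<in> S \<Longrightarrow> \<exists>\<epsilon>>0. \<exists>b. \<forall>y. dist y x < \<epsilon> \<longrightarrow> ereal b \<le> h y"
  obtains b where "\<And>y. y \<in> S \<Longrightarrow> ereal b \<le> h y"
proof -
  from assms(2) obtain \<epsilon> b where *: "\<And>x. x \<in> S \<Longrightarrow> \<epsilon> x > 0"
    "\<And>x y. x \<in> S \<Longrightarrow> dist y x < \<epsilon> x \<Longrightarrow> ereal (b x) \<le> h y"
    by metis
  have "S \<subseteq> (\<Union>x\<in>S. ball x (\<epsilon> x))" using *(1) by force
  then obtain T where T: "T \<subseteq> S" "finite T" "S \<subseteq> (\<Union>x\<in>T. ball x (\<epsilon> x))"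
    using compactE_image[OF assms(1), of S "\<lambda>x. ball x (\<epsilon> x)"] by auto
  show thesis
  proof (rule that)
    fix y assume "y \<in> S"
    with T obtain x where x: "x \<in> T" "dist y x < \<epsilon> x" by (auto simp: dist_commute)
    then have "Min (b ` T) \<le> b x" using T by simp
    also have "ereal (b x) \<le> h y" using * x T by blast
    finally show "ereal (Min (b ` T)) \<le> h y" by simp
  qed
qed

lemma sum_block_shift:
  fixes w :: "('a::ab_group_add)^'m" and k :: "'m \<Rightarrow> 'a \<Rightarrow> 'c::comm_monoid_add"
  shows "(\<Sum>i\<in>UNIV. k i ((w + axis j d) $ i)) = k j (w $ j + d) + (\<Sum>i\<in>UNIV - {j}. k i (w $ i))"
proof -
  have "(\<Sum>i\<in>UNIV - {j}. k i ((w + axis j d) $ i)) = (\<Sum>i\<in>UNIV - {j}. k i (w $ i))"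
    by (intro sum.cong) (auto simp: axis_def)
  then show ?thesis by (simp add: sum.remove[of UNIV j])
qed

lemma norm_axis: "norm (axis j x :: ('a::real_inner)^'m) = norm x"
  by (simp add: norm_eq_sqrt_inner inner_axis_axis)

lemma bounded_linear_axis: "bounded_linear (axis j :: 'a::real_inner \<Rightarrow> 'a^'m)"
proof (rule bounded_linear_intro[of _ 1])
  show "norm (axis j x :: 'a^'m) \<le> norm x * 1" for x :: 'a by (simp add: norm_axis)
qed (simp_all add: axis_def vec_eq_iff)

lemma axis_diff: "axis j (x - y) = axis j x - (axis j y :: ('a::real_inner)^'m)"
  by (rule bounded_linear.linear[OF bounded_linear_axis, THEN linear_diff])

text \<open>Moving only block \<open>j\<close> changes the separable sum by \<open>\<psi>\<close> and a constant. Finiteness of that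
  constant comes from finiteness of the sum, since a sum of extended reals is finite only if both
  terms are.\<close>
lemma has_egrad_separable_block:
  fixes w :: "real^'n^'m"
  assumes "has_egrad (separable_sum \<psi>) w g"
  shows "has_egrad \<psi> (w $ j) (g $ j)"
proof -
  define \<iota> where "\<iota> x = w + axis j (x - w $ j)" for x
  define C where "C = (\<Sum>i\<in>UNIV - {j}. \<psi> (w $ i))"
  have sep: "separable_sum \<psi> (\<iota> x) = \<psi> x + C" for x
    using sum_block_shift[of "\<lambda>_. \<psi>" w j "x - w $ j"]
    by (simp add: separable_sum_def \<iota>_def C_def)
  have \<iota>0: "\<iota> (w $ j) = w" by (simp add: \<iota>_def axis_def vec_eq_iff)
  have dax: "(axis j has_derivative axis j) (at x)" for x :: "real^'n"
    by (rule bounded_linear_imp_has_derivative[OF bounded_linear_axis])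
  have d\<iota>: "(\<iota> has_derivative axis j) (at (w $ j))"
    unfolding \<iota>_def axis_diff by (auto intro!: derivative_eq_intros dax)
  have fin0: "\<forall>\<^sub>F v in nhds (\<iota> (w $ j)). \<bar>separable_sum \<psi> v\<bar> \<noteq> \<infinity>"
    using assms by (simp add: \<iota>0 has_egrad_def)
  have "isCont \<iota> (w $ j)" using d\<iota> by (rule has_derivative_continuous)
  then have "filterlim \<iota> (nhds (\<iota> (w $ j))) (nhds (w $ j))"
    by (simp add: isCont_def tendsto_at_iff_tendsto_nhds)
  with fin0 have "\<forall>\<^sub>F x in nhds (w $ j). \<bar>separable_sum \<psi> (\<iota> x)\<bar> \<noteq> \<infinity>"
    by (rule eventually_compose_filterlim)
  then have fin: "\<forall>\<^sub>F x in nhds (w $ j). \<bar>\<psi> x + C\<bar> \<noteq> \<infinity>" by (simp only: sep)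
  have "((\<lambda>v. real_of_ereal (separable_sum \<psi> v)) has_derivative (\<lambda>h. inner h g)) (at (\<iota> (w $ j)))"
    using assms by (simp add: has_egrad_def gderiv_def \<iota>0)
  then have "((\<lambda>x. real_of_ereal (separable_sum \<psi> (\<iota> x))) has_derivative (\<lambda>h. inner (axis j h) g))
      (at (w $ j))"
    by (rule has_derivative_compose[OF d\<iota>])
  then have "GDERIV (\<lambda>x. real_of_ereal (separable_sum \<psi> (\<iota> x)) - real_of_ereal C) (w $ j) :> g $ j"
    unfolding gderiv_def by (auto intro!: derivative_eq_intros simp: inner_axis')
  then have "has_egrad (\<lambda>x. ereal (real_of_ereal (separable_sum \<psi> (\<iota> x)) - real_of_ereal C))
      (w $ j) (g $ j)"
    by (rule has_egrad_ereal)
  moreover have "\<forall>\<^sub>F x in nhds (w $ j).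
      ereal (real_of_ereal (separable_sum \<psi> (\<iota> x)) - real_of_ereal C) = \<psi> x"
    using fin
  proof (rule eventually_mono)
    fix x assume "\<bar>\<psi> x + C\<bar> \<noteq> \<infinity>"
    then show "ereal (real_of_ereal (separable_sum \<psi> (\<iota> x)) - real_of_ereal C) = \<psi> x"
      unfolding sep by (cases "\<psi> x"; cases C) auto
  qed
  ultimately show ?thesis by (rule has_egrad_cong[rotated])
qed

lemma separable_sum_axis:
  fixes \<psi> :: "real^'n \<Rightarrow> ereal"
  assumes "\<psi> 0 = 0"
  shows "separable_sum \<psi> (axis j x :: real^'n^'m) = \<psi> x"
  using sum_block_shift[of "\<lambda>_. \<psi>" "0 :: real^'n^'m" j x]
  by (simp add: separable_sum_def assms)

lemma separable_penalty_zero: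
  assumes "penalty_assms (separable_sum \<psi> :: real^'n^'m \<Rightarrow> ereal)"
  shows "\<psi> 0 = 0"
proof -
  have "(\<Sum>i\<in>(UNIV :: 'm set). \<psi> 0) = 0"
    using assms by (simp add: penalty_assms_def separable_sum_def)
  then show ?thesis by (simp add: sum_constant_ereal)
qed

text \<open>As \<open>\<psi> 0 = 0\<close>, the penalty \<open>\<psi>\<close> is the restriction of its separable sum to the axis of one block,
  so convexity, domain and derivatives restrict along the linear embedding \<open>axis j\<close>; the Hessian
  becomes its \<open>j\<close>-th diagonal block.\<close>
lemma smooth_penalty_block:
  assumes pa: "penalty_assms (separable_sum \<psi> :: real^'n^'m \<Rightarrow> ereal)"
  shows "smooth_penalty \<psi>"
proof -
  define \<phi> where "\<phi> = (separable_sum \<psi> :: real^'n^'m \<Rightarrow> ereal)"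
  \<comment> \<open>Any block serves; all of them carry the same summand.\<close>
  fix j :: 'm
  define ax where "ax = (axis j :: real^'n \<Rightarrow> real^'n^'m)"
  note pa = pa[folded \<phi>_def]
  have \<psi>0: "\<psi> 0 = 0" by (rule separable_penalty_zero[OF assms])
  have \<phi>ax: "\<phi> (ax x) = \<psi> x" for x
    unfolding \<phi>_def ax_def by (rule separable_sum_axis[of \<psi>, OF \<psi>0])
  have blax: "bounded_linear ax" unfolding ax_def by (rule bounded_linear_axis)
  interpret ax: bounded_linear ax by (rule blax)
  have op\<phi>: "open (edom \<phi>)" using pa by (simp add: penalty_assms_def)
  have dom: "x \<in> edom \<psi> \<longleftrightarrow> ax x \<in> edom \<phi>" for x by (simp add: edom_def \<phi>ax)
  have contax: "continuous_on S ax" for S by (rule ax.continuous_on) (rule continuous_on_id)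
  have "edom \<psi> = ax -` edom \<phi>" using dom by auto
  then have op: "open (edom \<psi>)" using op\<phi> contax[of UNIV] by (simp add: open_vimage)
  have lower: "\<psi> w \<noteq> -\<infinity>" for w
    using pa \<phi>ax[of w] unfolding penalty_assms_def legendre_def proper_fun_def
    by (metis less_irrefl)
  have conv: "convex_fun \<psi>"
    unfolding convex_fun_def
  proof (intro allI impI)
    fix x y :: "real^'n" and t :: real assume t: "0 < t \<and> t < 1"
    have "convex_fun \<phi>" using pa by (simp add: penalty_assms_def legendre_def)
    then have "\<phi> ((1 - t) *\<^sub>R ax x + t *\<^sub>R ax y) \<le> ereal (1 - t) * \<phi> (ax x) + ereal t * \<phi> (ax y)"
      using t unfolding convex_fun_def by blast
    then show "\<psi> ((1 - t) *\<^sub>R x + t *\<^sub>R y) \<le> ereal (1 - t) * \<psi> x + ereal t * \<psi> y"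
      by (simp only: ax.scaleR[symmetric] ax.add[symmetric] \<phi>ax)
  qed
  from pa have tw: "twice_cont_diff_pd \<phi>" by (simp add: penalty_assms_def)
  have eg: "has_egrad \<psi> x (egrad \<phi> (ax x) $ j)" if "x \<in> edom \<psi>" for x
  proof -
    have "ediff \<phi> (ax x)" using tw that op\<phi> by (simp add: twice_cont_diff_pd_def interior_open dom)
    then have "has_egrad \<psi> (ax x $ j) (egrad \<phi> (ax x) $ j)"
      using has_egrad_separable_block has_egrad_egrad unfolding \<phi>_def by blast
    then show ?thesis by (simp add: ax_def)
  qed
  from tw op\<phi> obtain H :: "real^'n^'m \<Rightarrow> (real^'n^'m) \<Rightarrow>\<^sub>L (real^'n^'m)"
    where contH: "continuous_on (edom \<phi>) H"
    and H: "\<And>w. w \<in> edom \<phi> \<Longrightarrow> (egrad \<phi> has_derivative blinfun_apply (H w)) (at w)"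
    and pd: "\<And>w d. w \<in> edom \<phi> \<Longrightarrow> d \<noteq> 0 \<Longrightarrow> 0 < inner d (blinfun_apply (H w) d)"
    unfolding twice_cont_diff_pd_def by (auto simp: interior_open)
  define K where "K x = Blinfun (\<lambda>v. v $ j) o\<^sub>L (H (ax x) o\<^sub>L Blinfun ax)" for x
  have K: "blinfun_apply (K x) d = H (ax x) (ax d) $ j" for x d
    by (simp add: K_def bounded_linear_Blinfun_apply blax bounded_linear_vec_nth)
  have "continuous_on (edom \<psi>) K"
  proof -
    have "continuous_on (edom \<psi>) (\<lambda>x. H (ax x))"
      by (rule continuous_on_compose2[OF contH contax]) (auto simp: dom)
    then show ?thesis unfolding K_def
      by (intro bounded_bilinear.continuous_on[OF bounded_bilinear_blinfun_compose]
          continuous_on_const)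
  qed
  moreover have "(egrad \<psi> has_derivative blinfun_apply (K x)) (at x)" if x: "x \<in> edom \<psi>" for x
  proof -
    have "(egrad \<phi> has_derivative blinfun_apply (H (ax x))) (at (ax x))" using H x dom by blast
    then have "((\<lambda>x. egrad \<phi> (ax x)) has_derivative (\<lambda>d. H (ax x) (ax d))) (at x)"
      by (rule has_derivative_compose[OF bounded_linear_imp_has_derivative[OF blax]])
    then have "((\<lambda>x. egrad \<phi> (ax x) $ j) has_derivative (\<lambda>d. H (ax x) (ax d) $ j)) (at x)"
      by (rule bounded_linear.has_derivative[OF bounded_linear_vec_nth])
    then have "((\<lambda>x. egrad \<phi> (ax x) $ j) has_derivative blinfun_apply (K x)) (at x)"
      by (simp add: K[abs_def])
    then show ?thesis
      by (rule has_derivative_transform_within_open[OF _ op x]) (simp add: egrad_eq[OF eg])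
  qed
  moreover have "0 < inner d (blinfun_apply (K x) d)" if "x \<in> edom \<psi>" "d \<noteq> 0" for x d
  proof -
    have "ax d \<noteq> 0" using that by (simp add: ax_def)
    then have "0 < inner (ax d) (H (ax x) (ax d))" using that dom pd by blast
    then show ?thesis by (simp add: K ax_def inner_axis')
  qed
  moreover have "ediff \<psi> x" if "x \<in> edom \<psi>" for x using eg[OF that] by (auto simp: ediff_def)
  ultimately have "twice_cont_diff_pd \<psi>"
    unfolding twice_cont_diff_pd_def interior_open[OF op] by blast
  moreover have "egrad \<psi> 0 = 0"
  proof -
    have "0 \<in> edom \<psi>" by (simp add: edom_def \<psi>0)
    moreover have "egrad \<phi> 0 = 0" using pa by (simp add: penalty_assms_def)
    ultimately show ?thesis using egrad_eq[OF eg] ax.zero by simp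
  qed
  ultimately show ?thesis
    unfolding smooth_penalty_def using lower conv op \<psi>0 by blast
qed

text \<open>Freezing the other blocks of both the argument and the base point at \<open>0\<close> makes their
  contribution to the envelope a constant, because \<open>\<psi> 0 = 0\<close>.\<close>
lemma prox_bound_block:
  fixes f :: "'m::finite \<Rightarrow> real^'n \<Rightarrow> real"
  assumes lam: "lam \<in> prox_bound_params (separable_sum \<psi>) (\<lambda>z. ereal (\<Sum>i\<in>UNIV. f i (z $ i)))"
    and \<psi>0: "\<psi> 0 = 0" and "compact S"
  obtains b where "\<And>v z. v \<in> S \<Longrightarrow> ereal b \<le> ereal (f j z) + ereal (1 / lam) * \<psi> (v - z)"
proof -
  define \<phi> where "\<phi> = (separable_sum \<psi> :: real^'n^'m \<Rightarrow> ereal)"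
  define F where "F z = ereal (\<Sum>i\<in>UNIV. f i (z $ i))" for z :: "real^'n^'m"
  \<comment> \<open>The value of the frozen blocks, by which the lower bound is shifted.\<close>
  define C where "C = (\<Sum>i\<in>UNIV - {j}. f i 0)"
  have F: "F (axis j z) = ereal (f j z + C)" for z
    using sum_block_shift[of f 0 j z] by (simp add: F_def C_def)
  have local: "\<exists>\<epsilon>>0. \<exists>b. \<forall>y. dist y x < \<epsilon> \<longrightarrow> ereal b \<le> envelope lam \<psi> (\<lambda>z. ereal (f j z)) y" for x
  proof -
    from lam obtain \<epsilon> \<beta> where \<epsilon>: "\<epsilon> > 0" "\<beta> > -\<infinity>"
      "\<And>v. norm (v - axis j x) \<le> \<epsilon> \<Longrightarrow> envelope lam \<phi> F v \<ge> \<beta>"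
      unfolding prox_bound_params_def \<phi>_def F_def[abs_def] by blast
    from \<epsilon>(2) obtain b where b: "ereal b \<le> \<beta>" by (cases \<beta>) auto
    have "ereal (b - C) \<le> envelope lam \<psi> (\<lambda>z. ereal (f j z)) y" if "dist y x < \<epsilon>" for y
      unfolding envelope_def
    proof (rule INF_greatest)
      fix z :: "real^'n"
      have "norm (axis j y - axis j x :: real^'n^'m) \<le> \<epsilon>"
        using that by (simp add: axis_diff[symmetric] norm_axis dist_norm)
      then have "ereal b \<le> envelope lam \<phi> F (axis j y)" using \<epsilon>(3) b order_trans by blast
      also have "\<dots> \<le> F (axis j z) + ereal (1 / lam) * \<phi> (axis j y - axis j z)"
        unfolding envelope_def by (rule INF_lower) simp
      also have "\<dots> = ereal (f j z + C) + ereal (1 / lam) * \<psi> (y - z)"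
        unfolding F \<phi>_def axis_diff[symmetric] separable_sum_axis[of \<psi>, OF \<psi>0] ..
      finally show "ereal (b - C) \<le> ereal (f j z) + ereal (1 / lam) * \<psi> (y - z)"
        by (cases "ereal (1 / lam) * \<psi> (y - z)") auto
    qed
    then show ?thesis using \<epsilon>(1) by blast
  qed
  obtain b where b: "\<And>v. v \<in> S \<Longrightarrow> ereal b \<le> envelope lam \<psi> (\<lambda>z. ereal (f j z)) v"
    using compact_uniform_lower_bound[OF \<open>compact S\<close> local] by blast
  show thesis
  proof (rule that)
    fix v z assume "v \<in> S"
    then show "ereal b \<le> ereal (f j z) + ereal (1 / lam) * \<psi> (v - z)"
      using b unfolding envelope_def by (meson INF_lower UNIV_I order_trans)
  qed
qed

lemma GDERIV_separable:
  fixes f :: "'m::finite \<Rightarrow> 'a::real_inner \<Rightarrow> real"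
  assumes "\<And>i z. GDERIV (f i) z :> g i z"
  shows "GDERIV (\<lambda>z. \<Sum>i\<in>UNIV. f i (z $ i)) z :> (\<chi> i. g i (z $ i))"
proof -
  have "((\<lambda>z. f i (z $ i)) has_derivative (\<lambda>h. inner (h $ i) (g i (z $ i)))) (at z)" for i
    by (rule has_derivative_compose[OF bounded_linear_imp_has_derivative[OF bounded_linear_vec_nth]
          assms[unfolded gderiv_def]])
  then show ?thesis
    unfolding gderiv_def by (simp add: inner_vec_def has_derivative_sum)
qed

lemma limiting_subdiff_separable:
  fixes f :: "'m::finite \<Rightarrow> real^'n \<Rightarrow> real"
  assumes gf: "\<And>i z. GDERIV (f i) z :> g i z" and cg: "\<And>i. continuous_on UNIV (g i)"
  shows "limiting_subdiff (\<lambda>z. ereal (\<Sum>i\<in>UNIV. f i (z $ i))) z = {\<chi> i. g i (z $ i)}"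
proof (rule limiting_subdiff_smooth[of "\<lambda>z. \<Sum>i\<in>UNIV. f i (z $ i)"])
  show "GDERIV (\<lambda>z. \<Sum>i\<in>UNIV. f i (z $ i)) z :> (\<chi> i. g i (z $ i))" for z
    by (rule GDERIV_separable[OF gf])
  show "continuous_on UNIV (\<lambda>z. \<chi> i. g i (z $ i))"
    by (intro continuous_on_vec_lambda continuous_on_compose2[OF cg] continuous_intros) auto
qed

text \<open>The prox-regularity inequality is tested at points that agree with \<open>zb\<close> outside block \<open>j\<close>; the
  gradient of the sum then differs from the one at \<open>zb\<close> in that block only.\<close>
lemma prox_regular_block:
  fixes f :: "'m::finite \<Rightarrow> real^'n \<Rightarrow> real"
  assumes pr: "prox_regular_with \<epsilon> r (\<lambda>z. ereal (\<Sum>i\<in>UNIV. f i (z $ i))) zb (\<chi> i. g i (zb $ i))"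
    and gf: "\<And>i z. GDERIV (f i) z :> g i z" and cg: "\<And>i. continuous_on UNIV (g i)"
    and z: "norm (z - zb $ j) < \<epsilon>" "f j z - f j (zb $ j) < \<epsilon>" "norm (g j z - g j (zb $ j)) < \<epsilon>"
    and z': "norm (z' - zb $ j) < \<epsilon>"
  shows "f j z' \<ge> f j z + inner (g j z) (z' - z) - r / 2 * (norm (z' - z))\<^sup>2"
proof -
  define \<iota> where "\<iota> x = zb + axis j (x - zb $ j)" for x
  let ?F = "\<lambda>z :: real^'n^'m. \<Sum>i\<in>UNIV. f i (z $ i)"
  let ?y = "\<chi> i. g i (\<iota> z $ i)"
  define C where "C = (\<Sum>i\<in>UNIV - {j}. f i (zb $ i))"
  have F: "?F (\<iota> x) = f j x + C" for x unfolding \<iota>_def C_def sum_block_shift by simp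
  have F0: "?F zb = f j (zb $ j) + C" unfolding C_def by (simp add: sum.remove[of UNIV j])
  have d: "\<iota> x - \<iota> x' = axis j (x - x')" for x x' by (simp add: \<iota>_def axis_diff)
  have "?y - (\<chi> i. g i (zb $ i)) = axis j (g j z - g j (zb $ j))"
    by (auto simp: vec_eq_iff \<iota>_def axis_def)
  then have y: "norm (?y - (\<chi> i. g i (zb $ i))) < \<epsilon>" using z(3) by (simp add: norm_axis)
  have "norm (\<iota> z' - zb) < \<epsilon>" "norm (\<iota> z - zb) < \<epsilon>" using z z' by (auto simp: \<iota>_def norm_axis)
  moreover have "ereal (?F (\<iota> z)) - ereal (?F zb) < ereal \<epsilon>" using z(2) by (simp add: F F0)
  moreover have "?y \<in> limiting_subdiff (\<lambda>z. ereal (?F z)) (\<iota> z)"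
    using limiting_subdiff_separable[of f g, OF gf cg] by simp
  ultimately have "ereal (?F (\<iota> z')) \<ge> ereal (?F (\<iota> z)) +
      ereal (inner ?y (\<iota> z' - \<iota> z) - r / 2 * (norm (\<iota> z' - \<iota> z))\<^sup>2)"
    using pr y unfolding prox_regular_with_def by blast
  moreover have "?y $ j = g j z" by (simp add: \<iota>_def)
  ultimately show ?thesis by (simp add: F d norm_axis inner_axis)
qed

lemma adjoint_stack: "adjoint (stack :: real^'n \<Rightarrow> real^'n^'m) y = (\<Sum>j\<in>UNIV. y $ j)"
proof (rule vector_eq_rdot[THEN iffD1], intro allI)
  fix x :: "real^'n"
  have lin: "linear (stack :: real^'n \<Rightarrow> real^'n^'m)"
    by (rule linearI) (auto simp: stack_def vec_eq_iff)
  have "inner x (adjoint stack y) = inner (stack x) y" by (rule adjoint_works[OF lin])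
  also have "\<dots> = (\<Sum>j\<in>UNIV. inner x (y $ j))"
    by (subst inner_vec_def) (simp add: stack_def)
  also have "\<dots> = inner x (\<Sum>j\<in>UNIV. y $ j)" by (rule inner_sum_right[symmetric])
  finally show "inner (adjoint stack y) x = inner (\<Sum>j\<in>UNIV. y $ j) x"
    by (simp add: inner_commute)
qed


section \<open>Stationarity of the summed envelopes\<close>

theorem corollary5p1:
  fixes \<I> :: "'i set" and \<I>s :: "'m::finite \<Rightarrow> 'i set"
    and x :: "'i \<Rightarrow> 'x" and h :: "'i \<Rightarrow> 'y"
    and loss :: "'y \<Rightarrow> 'p \<Rightarrow> real"
    and H :: "'x \<Rightarrow> real^'n \<Rightarrow> 'p"
    and R :: "real^'n \<Rightarrow> real"
    and f :: "'m \<Rightarrow> real^'n \<Rightarrow> real"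
    and fhat :: "real^'n \<Rightarrow> real"
    and F :: "real^'n^'m \<Rightarrow> ereal"
    and \<phi>h :: "real^'n \<Rightarrow> ereal"
    and \<phi> :: "real^'n^'m \<Rightarrow> ereal"
    and Z :: "(real^'n^'m) set"
    and \<epsilon> r :: real
  assumes "finite \<I>"
    and "\<And>j. \<I>s j \<subseteq> \<I> \<and> \<I>s j \<noteq> {}"
    and f_eq: "\<And>j. f j = empirical_risk loss H R x h (\<I>s j)"
    and fhat_eq: "fhat = empirical_risk loss H R x h \<I>"
    and "\<And>j. continuously_diff (f j)"
    and F_eq: "F = (\<lambda>z. ereal (\<Sum>j\<in>UNIV. f j (z $ j)))"
    and \<phi>_eq: "\<phi> = separable_sum \<phi>h"
    and "penalty_assms \<phi>"
    and "prox_bounded \<phi> F"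
    and "bounded Z"
  shows "\<exists>lam0>0. \<forall>lam (ub :: real^'n) (zb :: real^'n^'m).
     0 < lam \<and> lam < lam0 \<and> ereal lam < prox_threshold \<phi> F \<and> zb \<in> Z \<and>
     0 \<in> limiting_subdiff (splitting_objective lam \<phi>h f) (ub, zb) \<and>
     (\<forall>j. ub - zb $ j \<in> edom \<phi>h) \<and>
     0 = (1 / lam) *\<^sub>R adjoint stack (egrad \<phi> (stack ub - zb)) \<and>
     0 \<in> (\<lambda>y. y - (1 / lam) *\<^sub>R egrad \<phi> (stack ub - zb)) ` limiting_subdiff F zb \<and>
     prox_regular_with \<epsilon> r F zb ((1 / lam) *\<^sub>R egrad \<phi> (stack ub - zb))
     \<longrightarrow>
     lipschitz_diff_around (\<lambda>u. \<Sum>j\<in>UNIV. envelope lam \<phi>h (\<lambda>z. ereal (f j z)) u) ub \<and>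
     (\<forall>j. ediff (envelope lam \<phi>h (\<lambda>z. ereal (f j z))) ub) \<and>
     (\<Sum>j\<in>UNIV. egrad (envelope lam \<phi>h (\<lambda>z. ereal (f j z))) ub) = 0 \<and>
     ((\<forall>j. \<I>s j = \<I>) \<longrightarrow>
        (\<forall>j. f j = fhat) \<and>
        (\<forall>u. (\<Sum>j\<in>UNIV. egrad (envelope lam \<phi>h (\<lambda>z. ereal (f j z))) u) = 0 \<longleftrightarrow>
              0 = egrad (envelope lam \<phi>h (\<lambda>z. ereal (fhat z))) u) \<and>
        ediff (envelope lam \<phi>h (\<lambda>z. ereal (fhat z))) ub \<and>
        0 = egrad (envelope lam \<phi>h (\<lambda>z. ereal (fhat z))) ub \<and>
        (\<forall>j. ub = zb $ j) \<and>
        0 \<in> limiting_subdiff (\<lambda>z. ereal (fhat z)) ub)"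
proof -
  note pen = \<open>penalty_assms \<phi>\<close>[unfolded \<phi>_eq]
  have \<psi>: "smooth_penalty \<phi>h" by (rule smooth_penalty_block[OF pen])
  have \<psi>0: "\<phi>h 0 = 0" by (rule separable_penalty_zero[OF pen])
  have "\<forall>j. \<exists>g. continuous_on UNIV g \<and> (\<forall>z. GDERIV (f j) z :> g z)"
    using assms(5) unfolding continuously_diff_def by blast
  then obtain g where gf: "\<And>j z. GDERIV (f j) z :> g j z"
    and cg: "\<And>j. continuous_on UNIV (g j)"
    using choice by metis
  from \<open>prox_bounded \<phi> F\<close> obtain lam1 where lam1: "lam1 \<in> prox_bound_params \<phi> F"
    by (auto simp: prox_bounded_def)
  then have lam1_pos: "lam1 > 0" by (simp add: prox_bound_params_def)
  have bound: "\<exists>b. \<forall>v\<in>S. \<forall>z. ereal b \<le> ereal (f j z) + ereal (1 / lam1) * \<phi>h (v - z)"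
    if "compact S" for S j
    by (rule prox_bound_block[OF lam1[unfolded \<phi>_eq F_eq] \<psi>0 that, where j = j]) blast
  define e where "e j lam = envelope lam \<phi>h (\<lambda>z. ereal (f j z))" for j lam
  \<comment> \<open>The envelope theorem for block \<open>j\<close>, stated for all pairs at once so that finitely many
    thresholds for \<open>lam\<close> can be merged into one.\<close>
  define good where "good lam j \<longleftrightarrow> (\<forall>ub zb. zb \<in> Z \<longrightarrow> ub - zb $ j \<in> edom \<phi>h \<longrightarrow>
      g j (zb $ j) = (1 / lam) *\<^sub>R egrad \<phi>h (ub - zb $ j) \<longrightarrow>
      prox_regular_with \<epsilon> r F zb (\<chi> i. g i (zb $ i)) \<longrightarrow>
      lipschitz_diff_around (e j lam) ub \<and> has_egrad (e j lam) ub (g j (zb $ j)))" for lam j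
  have "\<forall>\<^sub>F lam in at_right 0. good lam j" for j
  proof (cases "\<epsilon> > 0 \<and> r \<ge> 0")
    case False
    then have "good lam j" for lam by (auto simp: good_def prox_regular_with_def)
    then show ?thesis by simp
  next
    case True
    have "bounded ((\<lambda>z. z $ j) ` Z)"
      using \<open>bounded Z\<close> by (rule bounded_linear_image[OF _ bounded_linear_vec_nth])
    then obtain lam0 where lam0: "lam0 > 0"
      and main: "\<And>lam ub b. 0 < lam \<Longrightarrow> lam < lam0 \<Longrightarrow> b \<in> (\<lambda>z. z $ j) ` Z \<Longrightarrow>
       ub - b \<in> edom \<phi>h \<Longrightarrow> g j b = (1 / lam) *\<^sub>R egrad \<phi>h (ub - b) \<Longrightarrow>
       (\<And>z z'. norm (z - b) < \<epsilon> \<Longrightarrow> norm (z' - b) < \<epsilon> \<Longrightarrow> f j z - f j b < \<epsilon> \<Longrightarrow>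
          norm (g j z - g j b) < \<epsilon> \<Longrightarrow>
          f j z' \<ge> f j z + inner (g j z) (z' - z) - r / 2 * (norm (z' - z))\<^sup>2) \<Longrightarrow>
       lipschitz_diff_around (e j lam) ub \<and> has_egrad (e j lam) ub (g j b)"
      unfolding e_def
      using envelope_lipschitz_diff_small_lam[OF \<psi> gf cg lam1_pos bound _ True[THEN conjunct1] True[THEN conjunct2],
        where B = "(\<lambda>z. z $ j) ` Z"] by blast
    show ?thesis
    proof (rule eventually_at_rightI[OF _ lam0])
      fix lam assume lam: "lam \<in> {0<..<lam0}"
      show "good lam j" unfolding good_def
      proof (intro allI impI)
        fix ub zb
        assume *: "zb \<in> Z" "ub - zb $ j \<in> edom \<phi>h"
          "g j (zb $ j) = (1 / lam) *\<^sub>R egrad \<phi>h (ub - zb $ j)"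
          and pr: "prox_regular_with \<epsilon> r F zb (\<chi> i. g i (zb $ i))"
        have hypo: "f j z' \<ge> f j z + inner (g j z) (z' - z) - r / 2 * (norm (z' - z))\<^sup>2"
          if "norm (z - zb $ j) < \<epsilon>" "norm (z' - zb $ j) < \<epsilon>" "f j z - f j (zb $ j) < \<epsilon>"
            "norm (g j z - g j (zb $ j)) < \<epsilon>" for z z'
          by (rule prox_regular_block[OF pr[unfolded F_eq] gf cg that(1,3,4,2)])
        have "0 < lam" "lam < lam0" "zb $ j \<in> (\<lambda>z. z $ j) ` Z" using lam *(1) by auto
        then show "lipschitz_diff_around (e j lam) ub \<and> has_egrad (e j lam) ub (g j (zb $ j))"
          by (rule main[OF _ _ _ *(2,3) hypo])
      qed
    qed
  qed
  then have "\<forall>\<^sub>F lam in at_right 0. \<forall>j. good lam j" by (rule eventually_all_finite)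
  then obtain lam0 where lam0: "lam0 > 0"
    and good: "\<And>lam j. 0 < lam \<Longrightarrow> lam < lam0 \<Longrightarrow> good lam j"
    unfolding eventually_at_right_field by auto
  have op: "open (edom \<phi>)" using \<open>penalty_assms \<phi>\<close> by (simp add: penalty_assms_def)
  show ?thesis
  proof (rule exI[of _ lam0], rule conjI[OF lam0], intro allI impI, elim conjE)
    fix lam and ub :: "real^'n" and zb :: "real^'n^'m"
    assume lam: "0 < lam" "lam < lam0" and zb: "zb \<in> Z"
      and dom: "\<forall>j. ub - zb $ j \<in> edom \<phi>h"
      and adj: "0 = (1 / lam) *\<^sub>R adjoint stack (egrad \<phi> (stack ub - zb))"
      and mem: "0 \<in> (\<lambda>y. y - (1 / lam) *\<^sub>R egrad \<phi> (stack ub - zb)) ` limiting_subdiff F zb"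
      and pr: "prox_regular_with \<epsilon> r F zb ((1 / lam) *\<^sub>R egrad \<phi> (stack ub - zb))"
    have y: "(1 / lam) *\<^sub>R egrad \<phi> (stack ub - zb) = (\<chi> i. g i (zb $ i))"
      using mem by (simp add: F_eq limiting_subdiff_separable[of f g, OF gf cg])
    have "stack ub - zb \<in> edom \<phi>"
      using dom by (auto simp: edom_def \<phi>_eq separable_sum_def stack_def sum_Pinfty less_top[symmetric])
    then have "ediff \<phi> (stack ub - zb)"
      using \<open>penalty_assms \<phi>\<close> op
      by (simp add: penalty_assms_def twice_cont_diff_pd_def interior_open)
    then have blk: "egrad \<phi>h (ub - zb $ j) = egrad \<phi> (stack ub - zb) $ j" for j
      using has_egrad_separable_block[of \<phi>h "stack ub - zb" _ j] has_egrad_egrad egrad_eq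
      unfolding \<phi>_eq by (fastforce simp: stack_def)
    have crit: "g j (zb $ j) = (1 / lam) *\<^sub>R egrad \<phi>h (ub - zb $ j)" for j
      using arg_cong[OF y, of "\<lambda>y. y $ j"] by (simp add: blk)
    have env: "lipschitz_diff_around (e j lam) ub \<and> has_egrad (e j lam) ub (g j (zb $ j))" for j
      using good[OF lam, of j] zb dom crit[of j] pr[unfolded y] unfolding good_def by blast
    have sum0: "(\<Sum>j\<in>UNIV. egrad (e j lam) ub) = 0"
    proof -
      have "(\<Sum>j\<in>UNIV. egrad (e j lam) ub) = (\<Sum>j\<in>UNIV. g j (zb $ j))"
        by (simp add: egrad_eq[OF env[THEN conjunct2]])
      also have "\<dots> = (1 / lam) *\<^sub>R adjoint stack (egrad \<phi> (stack ub - zb))"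
        by (simp add: adjoint_stack crit blk flip: scaleR_right.sum)
      finally show ?thesis using adj by simp
    qed
    have lipsum: "lipschitz_diff_around (\<lambda>u. \<Sum>j\<in>UNIV. e j lam u) ub"
      using env by (intro lipschitz_diff_around_sum) auto
    have ed: "ediff (e j lam) ub" for j using env by (auto simp: ediff_def)
    have last: "(\<forall>j. f j = fhat) \<and>
        (\<forall>u. (\<Sum>j\<in>UNIV. egrad (e j lam) u) = 0 \<longleftrightarrow>
              0 = egrad (envelope lam \<phi>h (\<lambda>z. ereal (fhat z))) u) \<and>
        ediff (envelope lam \<phi>h (\<lambda>z. ereal (fhat z))) ub \<and>
        0 = egrad (envelope lam \<phi>h (\<lambda>z. ereal (fhat z))) ub \<and>
        (\<forall>j. ub = zb $ j) \<and>
        0 \<in> limiting_subdiff (\<lambda>z. ereal (fhat z)) ub"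
      if same: "\<forall>j. \<I>s j = \<I>"
    proof -
      have ff: "f j = fhat" for j by (simp add: f_eq fhat_eq same)
      define eh where "eh = envelope lam \<phi>h (\<lambda>z. ereal (fhat z))"
      have ee: "e j lam = eh" for j by (simp add: e_def eh_def ff)
      have red: "(\<Sum>j\<in>(UNIV :: 'm set). egrad (e j lam) u) = 0 \<longleftrightarrow> 0 = egrad eh u" for u
        unfolding ee sum_constant_scaleR by auto
      have eh0: "egrad eh ub = 0" using sum0 red by metis
      have g0: "g j (zb $ j) = 0" for j
        using egrad_eq[OF env[of j, THEN conjunct2]] eh0 by (simp add: ee)
      have ubzb: "ub = zb $ j" for j
      \<comment> \<open>A nonzero \<open>ub - zb $ j\<close> would have a nonzero penalty gradient, by the growth estimate at the
        radius \<open>norm (ub - zb $ j)\<close> itself.\<close>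
      proof (rule ccontr)
        assume "ub \<noteq> zb $ j"
        then have "norm (ub - zb $ j) > 0" by simp
        from smooth_penalty_growth[OF \<psi> this] obtain c where "c > 0"
          "\<And>w. w \<in> edom \<phi>h \<Longrightarrow> norm w \<ge> norm (ub - zb $ j) \<Longrightarrow> norm (egrad \<phi>h w) \<ge> c"
          by metis
        then have "norm (egrad \<phi>h (ub - zb $ j)) > 0" using dom by fastforce
        then show False using crit[of j] g0[of j] lam by simp
      qed
      fix j :: 'm
      have "limiting_subdiff (\<lambda>z. ereal (fhat z)) ub = {g j ub}"
        using limiting_subdiff_smooth[of "f j" "g j" ub, OF gf cg] by (simp add: ff)
      then have "0 \<in> limiting_subdiff (\<lambda>z. ereal (fhat z)) ub"
        using g0[of j] ubzb[of j] by simp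
      then show ?thesis
        using ff red eh0 ed[unfolded ee] ubzb unfolding eh_def[symmetric] by auto
    qed
    show "lipschitz_diff_around (\<lambda>u. \<Sum>j\<in>UNIV. envelope lam \<phi>h (\<lambda>z. ereal (f j z)) u) ub \<and>
     (\<forall>j. ediff (envelope lam \<phi>h (\<lambda>z. ereal (f j z))) ub) \<and>
     (\<Sum>j\<in>UNIV. egrad (envelope lam \<phi>h (\<lambda>z. ereal (f j z))) ub) = 0 \<and>
     ((\<forall>j. \<I>s j = \<I>) \<longrightarrow>
        (\<forall>j. f j = fhat) \<and>
        (\<forall>u. (\<Sum>j\<in>UNIV. egrad (envelope lam \<phi>h (\<lambda>z. ereal (f j z))) u) = 0 \<longleftrightarrow>
              0 = egrad (envelope lam \<phi>h (\<lambda>z. ereal (fhat z))) u) \<and>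
        ediff (envelope lam \<phi>h (\<lambda>z. ereal (fhat z))) ub \<and>
        0 = egrad (envelope lam \<phi>h (\<lambda>z. ereal (fhat z))) ub \<and>
        (\<forall>j. ub = zb $ j) \<and>
        0 \<in> limiting_subdiff (\<lambda>z. ereal (fhat z)) ub)"
      unfolding e_def[symmetric] using lipsum ed sum0 last by blast
  qed
qed
end
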